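(* Let $k=\mathbb{F}_2$ and let $U(\mathcal{S}h)$ be the suboperad of $U(\mathcal{S})$ generated by the surjection-like elements. Then for every simplicial set $X$ the following diagram of operad morphisms commutes: for every $x\in U(\mathcal{S}h)(m)$, $$U(\varphi)_X(x)=\phi_X\big(\Psi(q(x))\big)\in\mathrm{End}(\mathrm{C}_\bullet(X))(m),$$ where $U(\varphi)_X:U(\mathcal{S})\to\mathrm{End}(\mathrm{C}_\bullet(X))$, $q:U(\mathcal{S}h)\to U(\mathcal{MS})$ (the restriction of the quotient map $U(\mathcal{S})\twoheadrightarrow U(\mathcal{MS})$), $\Psi:U(\mathcal{MS})\xrightarrow{\cong}Sur$ and $\phi_X:Sur\to\mathrm{End}(\mathrm{C}_\bullet(X))$ are as in the context.
   Context: Chain complexes over $\mathbb{F}_2$. A prop $\mathcal{P}$ is a strict symmetric monoidal category enriched in chain complexes generated by one object, $\mathcal{P}(n,m)$ the morphisms from $n$ to $m$ copies; $\circ$ vertical, $\otimes$ horizontal composition, $\mathrm{id}\in\mathcal{P}(1,1)$; $U(\mathcal{P})(m)=\mathcal{P}(1,m)$ with $x\circ_r y=(\mathrm{id}^{\otimes r-1}\otimes y\otimes\mathrm{id}^{\otimes m'-r})\circ x$. $\mathrm{End}(C)(m)=\mathrm{Hom}(C,C^{\otimes m})$. The prop $\mathcal{S}$: free prop on the free $\Sigma$-bimodule generated by $\varepsilon\in\mathcal{S}(1,0)_0$, $\Delta\in\mathcal{S}(1,2)_0$, $\mu\in\mathcal{S}(2,1)_1$, with derivation differential $\partial\varepsilon=0$,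 $\partial\Delta=0$, $\partial\mu=(\varepsilon\otimes\mathrm{id})-(\mathrm{id}\otimes\varepsilon)$, modulo the dg prop ideal generated by $\varepsilon\circ\mu$, $(\varepsilon\otimes\mathrm{id})\circ\Delta-\mathrm{id}$, $(\mathrm{id}\otimes\varepsilon)\circ\Delta-\mathrm{id}$. $\mathcal{MS}$ is its quotient by the dg prop ideal generated additionally by $\mu-\mu\cdot(12)$, $\mu\circ(\mu\otimes\mathrm{id})-\mu\circ(\mathrm{id}\otimes\mu)$, $(\Delta\otimes\mathrm{id})\circ\Delta-(\mathrm{id}\otimes\Delta)\circ\Delta$, $\Delta\circ\mu-(\mathrm{id}\otimes\mu)\circ(\Delta\otimes\mathrm{id})-(\mu\otimes\mathrm{id})\circ(\mathrm{id}\otimes\Delta)$, $\mu\circ\Delta$. Iterated operations: $\Delta^{(1)}=\mathrm{id}$, $\Delta^{(n+1)}=(\Delta^{(n)}\otimes\mathrm{id})\circ\Delta$; $\mu^{(1)}=\mathrm{id}$, $\mu^{(k+1)}=\mu\circ(\mu^{(k)}\otimes\mathrm{id})$. For a surjection $s:\{1,\dots,n\}\to\{1,\dots,m\}$ with $k_r=|s^{-1}(r)|$, the surjection-like element with associated surjection $s$ is $(\mu^{(k_1)}\otimes\cdots\otimes\mu^{(k_m)})\circ\tau_s\circ\Delta^{(n)}\in\mathcal{S}(1,m)$, where $\tau_s$ sends the $i$-th output of $\Delta^{(n)}$ to the $j$-th input of $\mu^{(k_{s(i)})}$, $j$ the position of $i$ in the ordered set $s^{-1}(s(i))$. The Surjection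 operad $Sur$: $Sur(m)$ is the quotient of the dg $\mathbb{F}_2$-module with basis all functions $s:\{1,\dots,n\}\to\{1,\dots,m\}$ ($n\ge1$, degree $n-m$, $\partial s=\sum_j s\circ\iota_j$ with $\iota_j$ the order-preserving injection missing $j$) by the span of non-surjective $s$ and of $s$ with $s(i)=s(i+1)$ for some $i$; $\Sigma_m$ acts by postcomposition; for $s'\in Sur(m')$ in which $r$ occurs at positions $i_1<\dots<i_k$ and $s\in Sur(m)$ of length $n$, $s'\circ_r s$ is the sum over $1=j_0\le j_1\le\dots\le j_k=n$ of the sequence obtained from $(s'(1),\dots,s'(n'))$ by replacing the entry at position $i_t$ by $(s(j_{t-1}),\dots,s(j_t))$ with entries raised by $r-1$, and raising entries $>r$ of $s'$ by $m-1$. $\Psi:U(\mathcal{MS})\to Sur$ is the operad isomorphism sending the class of a surjection-like element to its associated surjection. Chains: $\mathrm{C}_\bullet(\Delta^d)$ has basis $[v_0,\dots,v_q]$, $0\le v_0<\dots<v_q\le d$ (symbols with repeated vertices are $0$). $\varphi_d:\mathcal{S}\to\mathrm{End}(\mathrm{C}_\bullet(\Delta^d))$ is the prop morphism sending $\varepsilon$ to the augmentation, $\Delta$ to the Alexander–Whitney map $[v_0,\dots,v_q]\mapsto\sum_i[v_0,\dots,v_i]\otimes[v_i,\dots,v_q]$, and $\mu$ to the join $[v_0,\dots,v_p]\otimes[v_{p+1},\dots,v_q]\mapsto[\text{the vertices } v_0,\dots,v_q \text{ in increasing order}]$ if they are pairwise distinct and $0$ otherwise (signs irrelevant over $\mathbb{F}_2$).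 The Sur-coalgebra $\phi_d:Sur\to\mathrm{End}(\mathrm{C}_\bullet(\Delta^d))$: for $s=(s(1),\dots,s(n))\in Sur(m)$ and $\sigma=[v_0,\dots,v_d]$, $\phi_d(s)(\sigma)=\sum_I\sigma^1_I\otimes\cdots\otimes\sigma^m_I$, summed over $I=(i_0,\dots,i_n)$ with $0=i_0\le i_1\le\dots\le i_n=d$, where for $s^{-1}(r)=\{j_1<\dots<j_k\}$, $\sigma^r_I=[v_{i_{j_1-1}},\dots,v_{i_{j_1}},v_{i_{j_2-1}},\dots,v_{i_{j_2}},\dots,v_{i_{j_k-1}},\dots,v_{i_{j_k}}]$ if all these vertices are distinct and $0$ otherwise (on faces of $\Delta^d$ similarly). For a simplicial set $X$, $U(\varphi)_X$ and $\phi_X$ are the operad morphisms induced from the natural families $\{\varphi_d|_{U(\mathcal{S})}\}$ and $\{\phi_d\}$ by Kan extension: for a $d$-simplex $\sigma:\Delta^d\to X$ and an operation $x$ of arity $m$, $x(\sigma)=(\sigma_* )^{\otimes m}\big(x_d[0,\dots,d]\big)$. *)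

theory Defs
  imports Main "HOL-Library.Z2"
begin

text \<open>An F_2-linear combination of basis elements of type 'b is a function 'b => bit
  (finitely supported in all uses). A linear map is given by its values on basis elements.\<close>

type_synonym 'b vec = "'b \<Rightarrow> bit"

definition ind :: "'b \<Rightarrow> 'b vec" where
  "ind x = (\<lambda>w. if w = x then 1 else 0)"

definition supp :: "'b vec \<Rightarrow> 'b set" where
  "supp v = {u. v u \<noteq> 0}"

definition lin :: "('b \<Rightarrow> 'c vec) \<Rightarrow> 'b vec \<Rightarrow> 'c vec" where
  "lin f v = (\<lambda>w. \<Sum>u\<in>supp v. v u * f u w)"

text \<open>A basis simplex of C(Delta^d) is a list of vertices; a basis element of the
  tensor power C^{\<otimes> a} is a list of length a of such simplices.
  A map C^{\<otimes> a} -> C^{\<otimes> b} is given on basis elements.\<close>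

type_synonym smap = "nat list list \<Rightarrow> nat list list vec"

definition compose :: "smap \<Rightarrow> smap \<Rightarrow> smap" where
  "compose g f = (\<lambda>u. lin g (f u))"

definition tens :: "nat \<Rightarrow> nat \<Rightarrow> smap \<Rightarrow> smap \<Rightarrow> smap" where
  "tens a b f g = (\<lambda>u w. f (take a u) (take b w) * g (drop a u) (drop b w))"

definition idm :: smap where
  "idm = (\<lambda>u. ind u)"

text \<open>Alexander--Whitney diagonal (image of Delta under varphi_d)\<close>
definition aw :: smap where
  "aw u = (\<lambda>w. \<Sum>i<length (hd u). ind [take (Suc i) (hd u), drop i (hd u)] w)"

text \<open>join (image of mu under varphi_d)\<close>
definition join :: smap where
  "join u = (if distinct (u!0 @ u!1) then ind [sort (u!0 @ u!1)] else (\<lambda>_. 0))"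

primrec aw_iter :: "nat \<Rightarrow> smap" where
  "aw_iter 0 = idm"
| "aw_iter (Suc n) = (if n = 0 then idm else compose (tens 1 n (aw_iter n) idm) aw)"

primrec mu_iter :: "nat \<Rightarrow> smap" where
  "mu_iter 0 = idm"
| "mu_iter (Suc k) = (if k = 0 then idm else compose join (tens k 1 (mu_iter k) idm))"

primrec mus :: "nat list \<Rightarrow> smap" where
  "mus [] = idm"
| "mus (k # ks) = tens k 1 (mu_iter k) (mus ks)"

text \<open>The permutation tau_s (s given as the list (s(1),...,s(n)), values in 1..m):
  the i-th output of Delta^(n) goes to the block of mu^(k_{s(i)}) at the position of i
  in s^{-1}(s(i)).\<close>
definition tau_perm :: "nat \<Rightarrow> nat list \<Rightarrow> 'x list \<Rightarrow> 'x list" where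
  "tau_perm m s u = concat (map (\<lambda>r. map (\<lambda>i. u ! i) (filter (\<lambda>i. s ! i = r) [0..<length s])) [1..<Suc m])"

definition tau :: "nat \<Rightarrow> nat list \<Rightarrow> smap" where
  "tau m s = (\<lambda>u. ind (tau_perm m s u))"

text \<open>image under varphi_d of the surjection-like element with associated surjection s\<close>
definition surjlike :: "nat \<Rightarrow> nat list \<Rightarrow> smap" where
  "surjlike m s = compose (mus (map (\<lambda>r. length (filter (\<lambda>x. x = r) s)) [1..<Suc m]))
                          (compose (tau m s) (aw_iter (length s)))"

text \<open>Gen m s: the surjection-like element of the surjection s : {1..n} -> {1..m}
  (written as the list (s(1),...,s(n))); Comp x r y = x \<circ>_r y; Add x y = x + y.\<close>
datatype shtree = Gen nat "nat list" | Comp shtree nat shtree | Add shtree shtree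

primrec arity :: "shtree \<Rightarrow> nat" where
  "arity (Gen m s) = m"
| "arity (Comp x r y) = arity x + arity y - 1"
| "arity (Add x y) = arity x"

primrec wf_tree :: "shtree \<Rightarrow> bool" where
  "wf_tree (Gen m s) = (s \<noteq> [] \<and> set s = {1..m})"
| "wf_tree (Comp x r y) = (wf_tree x \<and> wf_tree y \<and> 1 \<le> r \<and> r \<le> arity x)"
| "wf_tree (Add x y) = (wf_tree x \<and> wf_tree y \<and> arity x = arity y)"

text \<open>varphi_d (as prop morphism, restricted to U(S)) applied to an element of U(Sh):
  x \<circ>_r y = (id^{r-1} \<otimes> y \<otimes> id^{m'-r}) \<circ> x\<close>
primrec evS :: "shtree \<Rightarrow> smap" where
  "evS (Gen m s) = surjlike m s"
| "evS (Comp x r y) = compose (tens (r - 1) (r - 1) idm (tens 1 (arity y) (evS y) idm)) (evS x)"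
| "evS (Add x y) = (\<lambda>u w. evS x u w + evS y u w)"

text \<open>Elements of Sur(m) are represented by F_2-combinations of sequences (nat list vec);
  sequences that are non-surjective or have equal consecutive entries represent 0
  in the quotient, and all maps below are well defined on the quotient.\<close>

definition sur_comp_basis :: "nat list \<Rightarrow> nat \<Rightarrow> nat \<Rightarrow> nat list \<Rightarrow> nat list vec" where
  "sur_comp_basis s' r m s =
    (let pos = filter (\<lambda>i. s' ! (i - 1) = r) [1..<Suc (length s')];
         k = length pos;
         n = length s;
         J = {js. length js = Suc k \<and> js ! 0 = 1 \<and> js ! k = n \<and> sorted js};
         build = (\<lambda>js. concat (map (\<lambda>p.
            if s' ! (p - 1) = r then
              (let t = length (filter (\<lambda>i. i < p) pos) + 1 in
               map (\<lambda>j. s ! (j - 1) + (r - 1)) [js ! (t - 1)..<Suc (js ! t)])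
            else if s' ! (p - 1) < r then [s' ! (p - 1)]
            else [s' ! (p - 1) + (m - 1)]) [1..<Suc (length s')]))
     in (\<lambda>w. \<Sum>js\<in>J. ind (build js) w))"

definition sur_comp :: "nat list vec \<Rightarrow> nat \<Rightarrow> nat \<Rightarrow> nat list vec \<Rightarrow> nat list vec" where
  "sur_comp z' r m z = (\<lambda>w. \<Sum>s'\<in>supp z'. \<Sum>s\<in>supp z. z' s' * z s * sur_comp_basis s' r m s w)"

text \<open>Psi(q(x)): Psi o q is an operad morphism sending surjection-like elements to
  their associated surjections\<close>
primrec Psi_q :: "shtree \<Rightarrow> nat list vec" where
  "Psi_q (Gen m s) = ind s"
| "Psi_q (Comp x r y) = sur_comp (Psi_q x) r (arity y) (Psi_q y)"
| "Psi_q (Add x y) = (\<lambda>w. Psi_q x w + Psi_q y w)"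

definition phi_sur_basis :: "nat list \<Rightarrow> nat \<Rightarrow> nat list \<Rightarrow> nat list list vec" where
  "phi_sur_basis v m s =
    (let n = length s; d = length v - 1;
         Is = {I. length I = Suc n \<and> I ! 0 = 0 \<and> I ! n = d \<and> sorted I};
         face = (\<lambda>I r. concat (map (\<lambda>j. map (\<lambda>i. v ! i) [I ! (j - 1)..<Suc (I ! j)])
                                    (filter (\<lambda>j. s ! (j - 1) = r) [1..<Suc n])))
     in (\<lambda>w. \<Sum>I\<in>Is. (if (\<forall>r\<in>{1..m}. distinct (face I r))
                         then ind (map (face I) [1..<Suc m]) w else 0)))"

definition phi_sur :: "nat list \<Rightarrow> nat \<Rightarrow> nat list vec \<Rightarrow> nat list list vec" where
  "phi_sur v m z = lin (phi_sur_basis v m) z"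

text \<open>A simplicial set: sets X d of d-simplices and, for sigma in X d and a monotone map
  theta : [q] -> [d] (written as the list (theta(0),...,theta(q))), the simplex act d theta sigma
  in X q, functorially.\<close>
definition mono_list :: "nat \<Rightarrow> nat list \<Rightarrow> bool" where
  "mono_list d th = (th \<noteq> [] \<and> sorted th \<and> (\<forall>x\<in>set th. x \<le> d))"

definition is_sset :: "(nat \<Rightarrow> 'a set) \<Rightarrow> (nat \<Rightarrow> nat list \<Rightarrow> 'a \<Rightarrow> 'a) \<Rightarrow> bool" where
  "is_sset X act =
    ((\<forall>d th \<sigma>. \<sigma> \<in> X d \<and> mono_list d th \<longrightarrow> act d th \<sigma> \<in> X (length th - 1))
   \<and> (\<forall>d \<sigma>. \<sigma> \<in> X d \<longrightarrow> act d [0..<Suc d] \<sigma> = \<sigma>)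
   \<and> (\<forall>d th et \<sigma>. \<sigma> \<in> X d \<and> mono_list d th \<and> mono_list (length th - 1) et \<longrightarrow>
        act (length th - 1) et (act d th \<sigma>) = act d (map (\<lambda>i. th ! i) et) \<sigma>))"

definition degen :: "nat \<Rightarrow> nat \<Rightarrow> nat list" where
  "degen q i = map (\<lambda>j. if j \<le> i then j else j - 1) [0..<Suc (Suc q)]"

definition nondeg :: "(nat \<Rightarrow> 'a set) \<Rightarrow> (nat \<Rightarrow> nat list \<Rightarrow> 'a \<Rightarrow> 'a) \<Rightarrow> nat \<Rightarrow> 'a \<Rightarrow> bool" where
  "nondeg X act q \<sigma> = (\<sigma> \<in> X q \<and>
     \<not> (\<exists>p i \<tau>. q = Suc p \<and> i \<le> p \<and> \<tau> \<in> X p \<and> \<sigma> = act p (degen p i) \<tau>))"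

text \<open>Basis of the normalized chains C(X): pairs (q, sigma) with sigma a nondegenerate
  q-simplex; basis of C(X)^{\<otimes> m}: lists of such pairs.
  (sigma_* )^{\<otimes> m} for sigma in X d, on a basis tensor of C(Delta^d)^{\<otimes> m}:\<close>
definition push :: "(nat \<Rightarrow> 'a set) \<Rightarrow> (nat \<Rightarrow> nat list \<Rightarrow> 'a \<Rightarrow> 'a) \<Rightarrow> nat \<Rightarrow> 'a
                    \<Rightarrow> nat list list \<Rightarrow> (nat \<times> 'a) list vec" where
  "push X act d \<sigma> u =
    (if (\<forall>v\<in>set u. nondeg X act (length v - 1) (act d v \<sigma>))
     then ind (map (\<lambda>v. (length v - 1, act d v \<sigma>)) u) else (\<lambda>_. 0))"

text \<open>Kan extension: x(sigma) = (sigma_* )^{\<otimes> m}(x_d[0,...,d])\<close>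
definition kan :: "(nat \<Rightarrow> 'a set) \<Rightarrow> (nat \<Rightarrow> nat list \<Rightarrow> 'a \<Rightarrow> 'a) \<Rightarrow> nat \<Rightarrow> 'a
                   \<Rightarrow> nat list list vec \<Rightarrow> (nat \<times> 'a) list vec" where
  "kan X act d \<sigma> y = lin (push X act d \<sigma>) y"

definition Uphi_X :: "(nat \<Rightarrow> 'a set) \<Rightarrow> (nat \<Rightarrow> nat list \<Rightarrow> 'a \<Rightarrow> 'a) \<Rightarrow> shtree \<Rightarrow> nat \<Rightarrow> 'a
                      \<Rightarrow> (nat \<times> 'a) list vec" where
  "Uphi_X X act x d \<sigma> = kan X act d \<sigma> (evS x [[0..<Suc d]])"

definition phi_X :: "(nat \<Rightarrow> 'a set) \<Rightarrow> (nat \<Rightarrow> nat list \<Rightarrow> 'a \<Rightarrow> 'a) \<Rightarrow> nat \<Rightarrow> nat list vec \<Rightarrow> nat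
                     \<Rightarrow> 'a \<Rightarrow> (nat \<times> 'a) list vec" where
  "phi_X X act m z d \<sigma> = kan X act d \<sigma> (phi_sur [0..<Suc d] m z)"

end

theory Submission
  imports Defs
begin

text \<open>
  Both sides are sums over ways of cutting a list into overlapping consecutive pieces (each piece
  begins with the last entry of its predecessor), so it suffices to identify the chain-level
  operations on strictly increasing lists of vertices. For a single surjection this is the
  iterated Alexander--Whitney formula. For a composition, let \<open>k\<close> vertex intervals be
  assigned to the label \<open>r\<close>. Cutting their concatenation into \<open>n\<close> pieces amounts to cutting
  the \<open>n\<close> letters of the inserted sequence into \<open>k\<close> overlapping runs and then each of the
  \<open>k\<close> intervals into as many pieces as its run has letters: between two consecutive intervals
  exactly one piece straddles the boundary, and its letter is the common end of two runs.
  No quotient is needed: the identity already holds for arbitrary sequences, because a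
  repeated vertex in the \<open>r\<close>-th face survives as a repetition inside one of the pieces.
\<close>

section \<open>Sums over cuts of a list into overlapping pieces\<close>

text \<open>
  Consecutive pieces share one entry. The value at \<open>0\<close> (an empty cut exists only when there is
  nothing to traverse) makes the recursion and \<open>sum_cuts_add\<close> below hold without exceptions.
\<close>

fun cuts :: "nat \<Rightarrow> 'x list \<Rightarrow> 'x list list set" where
  "cuts 0 w = (if length w = 1 then {[]} else {})"
| "cuts (Suc n) w = (\<Union>i<length w. (#) (take (Suc i) w) ` cuts n (drop i w))"

lemma finite_cuts [simp]: "finite (cuts n w)"
  by (induction n arbitrary: w) auto

lemma cuts_Nil [simp]: "cuts n [] = {}"
  by (cases n) auto

lemma length_cuts: "P \<in> cuts n w \<Longrightarrow> length P = n"
  by (induction n arbitrary: w P) (auto split: if_splits)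

lemma sum_cuts_Suc:
  fixes F :: "'x list list \<Rightarrow> 'b :: comm_monoid_add"
  shows "(\<Sum>P\<in>cuts (Suc n) w. F P)
    = (\<Sum>i<length w. \<Sum>P\<in>cuts n (drop i w). F (take (Suc i) w # P))"
proof -
  have "(\<Sum>P\<in>cuts (Suc n) w. F P)
      = (\<Sum>i<length w. \<Sum>P\<in>(#) (take (Suc i) w) ` cuts n (drop i w). F P)"
    unfolding cuts.simps
  proof (rule sum.UNION_disjoint)
    show "\<forall>i\<in>{..<length w}. \<forall>j\<in>{..<length w}. i \<noteq> j \<longrightarrow>
        (#) (take (Suc i) w) ` cuts n (drop i w) \<inter> (#) (take (Suc j) w) ` cuts n (drop j w) = {}"
    proof (intro ballI impI)
      fix i j assume "i \<in> {..<length w}" "j \<in> {..<length w}" "i \<noteq> j"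
      then have "length (take (Suc i) w) \<noteq> length (take (Suc j) w)" by simp
      then have "take (Suc i) w \<noteq> take (Suc j) w" by metis
      then show "(#) (take (Suc i) w) ` cuts n (drop i w) \<inter> (#) (take (Suc j) w) ` cuts n (drop j w) = {}"
        by auto
    qed
  qed auto
  then show ?thesis by (simp add: sum.reindex)
qed

lemma sum_cuts_0:
  fixes F :: "'x list list \<Rightarrow> 'b :: comm_monoid_add"
  shows "(\<Sum>P\<in>cuts 0 w. F P) = (if length w = 1 then F [] else 0)"
  by simp

lemma sum_cuts_1:
  fixes F :: "'x list list \<Rightarrow> 'b :: comm_monoid_add"
  assumes "w \<noteq> []"
  shows "(\<Sum>P\<in>cuts (Suc 0) w. F P) = F [w]"
proof -
  have "(\<Sum>P\<in>cuts (Suc 0) w. F P)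
      = (\<Sum>i<length w. if i = length w - 1 then F [take (Suc i) w] else 0)"
    unfolding sum_cuts_Suc sum_cuts_0 by (rule sum.cong) auto
  also have "\<dots> = F [w]" using assms by simp
  finally show ?thesis .
qed

text \<open>The inner index on the left is a distance from \<open>i\<close>; on the right it is an
  absolute position. In \<open>sum_cuts_add\<close> these describe where an initial run of pieces
  ends, seen from the end of its first piece or from the start of the list.\<close>

lemma sum_triangle_shift:
  fixes g :: "nat \<Rightarrow> nat \<Rightarrow> 'b :: comm_monoid_add"
  shows "(\<Sum>i<n. \<Sum>k<n - i. g i (i + k)) = (\<Sum>j<n. \<Sum>i<Suc j. g i j)"
proof -
  have "(\<Sum>i<n. \<Sum>k<n - i. g i (i + k)) = (\<Sum>(i,k)\<in>{(i,k). i + k < n}. g i (i + k))"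
  proof -
    have "{(i,k). i + k < n} = (SIGMA i:{..<n}. {..<n - i})" by auto
    then show ?thesis by (simp add: sum.Sigma)
  qed
  also have "\<dots> = (\<Sum>j<n. \<Sum>i\<le>j. g i j)"
    by (subst sum.triangle_reindex) (auto intro!: sum.cong)
  finally show ?thesis by (simp add: lessThan_Suc_atMost)
qed

lemma sum_swap_outer:
  fixes E :: "'i \<Rightarrow> 'p \<Rightarrow> 'q \<Rightarrow> 'b :: comm_monoid_add"
  shows "(\<Sum>i\<in>I. \<Sum>p\<in>A i. \<Sum>q\<in>J. E i p q) = (\<Sum>q\<in>J. \<Sum>i\<in>I. \<Sum>p\<in>A i. E i p q)"
proof -
  have "(\<Sum>p\<in>A i. \<Sum>q\<in>J. E i p q) = (\<Sum>q\<in>J. \<Sum>p\<in>A i. E i p q)" for i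
    by (rule sum.swap)
  then show ?thesis by (simp only: sum.swap[of _ J I])
qed

text \<open>The inner index set may depend on \<open>i\<close> and \<open>q\<close> but not on
  \<open>p\<close>. In \<open>sum_cuts_compose\<close> this lets the letter of the straddling piece
  be chosen before \<open>v\<close> is cut.\<close>

lemma sum_swap_under:
  fixes E :: "'i \<Rightarrow> 'p \<Rightarrow> 'q \<Rightarrow> 'x \<Rightarrow> 'b :: comm_monoid_add"
  shows "(\<Sum>i\<in>I. \<Sum>p\<in>A i. \<Sum>q\<in>J. \<Sum>x\<in>B i q. E i p q x)
    = (\<Sum>q\<in>J. \<Sum>i\<in>I. \<Sum>x\<in>B i q. \<Sum>p\<in>A i. E i p q x)"
  unfolding sum_swap_outer
  by (intro sum.cong[OF refl] sum.swap)

lemma sum_lessThan_add: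
  fixes h :: "nat \<Rightarrow> 'b :: comm_monoid_add"
  shows "(\<Sum>i<m + n. h i) = (\<Sum>i<m. h i) + (\<Sum>i<n. h (m + i))"
  by (induction n) (simp_all add: add.assoc)

text \<open>A cut is split where its first \<open>j\<close> pieces end; the entry at that position
  belongs to both halves. For \<open>j = 0\<close> only \<open>i = 0\<close> contributes, because
  only a list of length one has an empty cut.\<close>

lemma sum_cuts_add:
  fixes G :: "'x list list \<Rightarrow> 'b :: comm_monoid_add"
  shows "(\<Sum>P\<in>cuts (j + l) v. G P)
    = (\<Sum>i<length v. \<Sum>P\<in>cuts j (take (Suc i) v). \<Sum>Q\<in>cuts l (drop i v). G (P @ Q))"
proof (induction j arbitrary: v G)
  case 0
  show ?case
  proof (cases "v = []")
    case False
    have "(\<Sum>i<length v. \<Sum>P\<in>cuts 0 (take (Suc i) v). \<Sum>Q\<in>cuts l (drop i v). G (P @ Q))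
      = (\<Sum>i<length v. if i = 0 then \<Sum>Q\<in>cuts l (drop i v). G Q else 0)"
      by (rule sum.cong) auto
    then show ?thesis using False by simp
  qed simp
next
  case (Suc j)
  \<comment> \<open>Here \<open>i\<close> is the end of the first piece and \<open>k\<close> the end
    of the first \<open>Suc j\<close> pieces, both as positions in \<open>v\<close>.\<close>
  define g where "g i k = (\<Sum>P\<in>cuts j (take (Suc k - i) (drop i v)).
      \<Sum>Q\<in>cuts l (drop k v). G (take (Suc i) v # P @ Q))" for i k
  have "(\<Sum>P\<in>cuts (Suc j + l) v. G P) = (\<Sum>i<length v. \<Sum>k<length v - i. g i (i + k))"
    unfolding add_Suc sum_cuts_Suc Suc.IH g_def by (simp add: Suc_diff_le add.commute)
  also have "\<dots> = (\<Sum>k<length v. \<Sum>i<Suc k. g i k)" by (rule sum_triangle_shift)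
  also have "\<dots> = (\<Sum>k<length v. \<Sum>P\<in>cuts (Suc j) (take (Suc k) v). \<Sum>Q\<in>cuts l (drop k v). G (P @ Q))"
    unfolding sum_cuts_Suc g_def
    by (intro sum.cong) (auto simp: min_def drop_take)
  finally show ?case .
qed

text \<open>Produces the piece that straddles the boundary between two concatenated lists. Its two
  halves share no entry, unlike neighbouring pieces of a cut.\<close>

definition merge :: "'x list list \<Rightarrow> 'x list list \<Rightarrow> 'x list list" where
  "merge P Q = butlast P @ [last P @ hd Q] @ tl Q"

text \<open>The last entry of \<open>B\<close> and the first of \<open>W\<close> are neighbours, and
  two neighbouring positions lie together in exactly one piece. The index \<open>j\<close> counts
  the pieces before that one.\<close>

lemma sum_cuts_append:
  fixes G :: "'x list list \<Rightarrow> 'b :: comm_monoid_add"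
  assumes "B \<noteq> []" "W \<noteq> []"
  shows "(\<Sum>Q\<in>cuts n (B @ W). G Q)
    = (\<Sum>j<n. \<Sum>P\<in>cuts (Suc j) B. \<Sum>Q\<in>cuts (n - j) W. G (merge P Q))"
  using assms(1)
proof (induction n arbitrary: B G)
  case 0
  then show ?case using assms(2) by (cases B; cases W) auto
next
  case (Suc n)
  define h where "h i = (\<Sum>Q\<in>cuts n (drop i (B @ W)). G (take (Suc i) (B @ W) # Q))" for i
  have "(\<Sum>Q\<in>cuts (Suc n) (B @ W). G Q) = (\<Sum>i<length B + length W. h i)"
    unfolding sum_cuts_Suc h_def by simp
  also have "\<dots> = (\<Sum>i<length B. h i) + (\<Sum>i<length W. h (length B + i))"
    by (simp add: sum_lessThan_add)
  \<comment> \<open>If the first piece already reaches into \<open>W\<close>, it contains all of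
    \<open>B\<close>; this is the summand \<open>j = 0\<close>.\<close>
  also have "(\<Sum>i<length W. h (length B + i))
      = (\<Sum>P\<in>cuts (Suc 0) B. \<Sum>Q\<in>cuts (Suc n) W. G (merge P Q))"
    unfolding sum_cuts_1[OF Suc.prems] unfolding sum_cuts_Suc h_def merge_def by simp
  \<comment> \<open>If the first piece ends inside \<open>B\<close>, the rest of \<open>B\<close>
    still contains the shared entry, hence is nonempty, and the induction hypothesis applies to
    it.\<close>
  also have "(\<Sum>i<length B. h i)
      = (\<Sum>i<length B. \<Sum>j<n. \<Sum>P\<in>cuts (Suc j) (drop i B). \<Sum>Q\<in>cuts (n - j) W.
          G (merge (take (Suc i) B # P) Q))"
  proof (rule sum.cong)
    fix i assume "i \<in> {..<length B}"
    then have "h i = (\<Sum>Q\<in>cuts n (drop i B @ W). G (take (Suc i) B # Q))"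
      by (simp add: h_def)
    also have "\<dots> = (\<Sum>j<n. \<Sum>P\<in>cuts (Suc j) (drop i B). \<Sum>Q\<in>cuts (n - j) W.
          G (take (Suc i) B # merge P Q))"
      using \<open>i \<in> _\<close> by (intro Suc.IH) simp
    also have "\<dots> = (\<Sum>j<n. \<Sum>P\<in>cuts (Suc j) (drop i B). \<Sum>Q\<in>cuts (n - j) W.
          G (merge (take (Suc i) B # P) Q))"
      by (intro sum.cong refl) (auto simp: merge_def dest: length_cuts)
    finally show "h i = \<dots>" .
  qed simp
  also have "\<dots> = (\<Sum>j<n. \<Sum>P\<in>cuts (Suc (Suc j)) B. \<Sum>Q\<in>cuts (n - j) W. G (merge P Q))"
    by (subst sum.swap) (simp only: sum_cuts_Suc[where w = B])
  finally show ?case by (simp only: sum.lessThan_Suc_shift diff_zero diff_Suc_Suc add.commute)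
qed

subsection \<open>Substituting one labelled sequence into another\<close>

text \<open>If \<open>P\<close> cuts a simplex into as many pieces as \<open>s\<close> has letters,
  this is the tensor factor with index \<open>c\<close> in the interval-cut formula of the
  Sur-coalgebra.\<close>

fun gather :: "'l \<Rightarrow> 'l list \<Rightarrow> 'x list list \<Rightarrow> 'x list" where
  "gather c (a # s) (p # P) = (if a = c then p else []) @ gather c s P"
| "gather c _ _ = []"

lemma gather_append:
  "length s = length P \<Longrightarrow> gather c (s @ t) (P @ Q) = gather c s P @ gather c t Q"
  by (induction s P rule: list_induct2) auto

lemma gather_notin: "c \<notin> set s \<Longrightarrow> gather c s P = []"
  by (induction c s P rule: gather.induct) auto

lemma gather_map_inj:
  "(\<And>a. a \<in> set s \<Longrightarrow> f a = f c \<longleftrightarrow> a = c) \<Longrightarrow> gather (f c) (map f s) P = gather c s P"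
  by (induction c s P rule: gather.induct) auto

text \<open>The glued piece carries the letter \<open>s ! j\<close>, which ends
  \<open>take (Suc j) s\<close> and begins \<open>drop j s\<close>. Thus the runs of letters overlap
  exactly as the pieces of a cut of \<open>s\<close> do.\<close>

lemma gather_merge:
  assumes "length P = Suc j" "length Q = length s - j" "j < length s"
  shows "gather c s (merge P Q) = gather c (take (Suc j) s) P @ gather c (drop j s) Q"
proof -
  obtain P' p where P: "P = P' @ [p]" using assms by (cases P rule: rev_cases) auto
  obtain q Q' where Q: "Q = q # Q'" using assms by (cases Q) auto
  have s: "s = take j s @ s ! j # drop (Suc j) s" using assms id_take_nth_drop by blast
  have t: "take (Suc j) s = take j s @ [s ! j]" "drop j s = s ! j # drop (Suc j) s"
    using assms by (auto simp: take_Suc_conv_app_nth Cons_nth_drop_Suc)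
  have "gather c s (merge P Q) = gather c (take j s @ s ! j # drop (Suc j) s) (P' @ (p @ q) # Q')"
    using s by (simp add: P Q merge_def)
  then show ?thesis unfolding t using assms by (simp add: P Q gather_append)
qed

lemma cuts_nonempty: "P \<in> cuts n w \<Longrightarrow> p \<in> set P \<Longrightarrow> p \<noteq> []"
  by (induction n arbitrary: w P) (auto split: if_splits)

lemma gather_nonempty:
  "length P = length s \<Longrightarrow> c \<in> set s \<Longrightarrow> [] \<notin> set P \<Longrightarrow> gather c s P \<noteq> []"
  by (induction c s P rule: gather.induct) auto

text \<open>If \<open>T\<close> cuts the inserted sequence into as many runs as \<open>r\<close>
  occurs in \<open>s\<close>, this is one summand of the operadic composition; \<open>f\<close>
  renumbers the letters that stay.\<close>

fun substitute :: "'l \<Rightarrow> ('l \<Rightarrow> 'k) \<Rightarrow> 'l list \<Rightarrow> 'k list list \<Rightarrow> 'k list" where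
  "substitute r f [] T = []"
| "substitute r f (a # s) T = (if a = r then hd T @ substitute r f s (tl T) else f a # substitute r f s T)"

lemma substitute_notin: "r \<notin> set s \<Longrightarrow> substitute r f s T = map f s"
  by (induction s) auto

text \<open>
  \<open>L\<close> is the set of labels carried by the inserted sequence \<open>s\<close>; it has to avoid the
  relabelled remaining entries of \<open>s'\<close>, since otherwise the pieces would interleave.
\<close>

lemma sum_cuts_compose:
  fixes F :: "('k \<Rightarrow> 'x list) \<Rightarrow> 'b :: comm_monoid_add"
  assumes "r \<in> set s'" "s \<noteq> []" "set s \<subseteq> L" "\<And>a. a \<in> set s' \<Longrightarrow> f a \<in> L \<longleftrightarrow> a = r"
  shows "(\<Sum>P\<in>cuts (length s') v. \<Sum>Q\<in>cuts (length s) (gather r s' P).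
            F (\<lambda>c. if c \<in> L then gather c s Q else gather c (map f s') P))
       = (\<Sum>T\<in>cuts (count_list s' r) s. \<Sum>R\<in>cuts (length (substitute r f s' T)) v.
            F (\<lambda>c. gather c (substitute r f s' T) R))"
  using assms
proof (induction s' arbitrary: s v F)
  case Nil
  then show ?case by simp
next
  case (Cons a s')
  \<comment> \<open>A head other than \<open>r\<close> takes its piece of \<open>v\<close> along
    unchanged. At the last \<open>r\<close> the rest of the inserted sequence cuts a single
    interval. At an earlier \<open>r\<close> one piece straddles the boundary to the next
    interval.\<close>
  consider (other) "a \<noteq> r" "r \<in> set s'" | (last) "a = r" "r \<notin> set s'" | (inner) "a = r" "r \<in> set s'"
    using Cons.prems by auto
  then show ?case
  proof cases
    case other
    \<comment> \<open>As \<open>f a\<close> lies outside \<open>L\<close>, the first piece can only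
      enter the second branch and may be moved in front of the case distinction.\<close>
    have *: "(\<lambda>c. if c \<in> L then gather c s Q else (if f a = c then p else []) @ A c)
      = (\<lambda>c. (if f a = c then p else []) @ (if c \<in> L then gather c s Q else A c))" for Q p and A :: "'k \<Rightarrow> 'x list"
      using other Cons.prems(4)[of a] by (auto simp: fun_eq_iff)
    have "(\<Sum>P\<in>cuts (length (a # s')) v. \<Sum>Q\<in>cuts (length s) (gather r (a # s') P).
            F (\<lambda>c. if c \<in> L then gather c s Q else gather c (map f (a # s')) P))
      = (\<Sum>i<length v. \<Sum>P\<in>cuts (length s') (drop i v). \<Sum>Q\<in>cuts (length s) (gather r s' P).
            F (\<lambda>c. (if f a = c then take (Suc i) v else [])
                @ (if c \<in> L then gather c s Q else gather c (map f s') P)))"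
      unfolding length_Cons sum_cuts_Suc using other * by (simp cong: if_cong)
    also have "\<dots> = (\<Sum>i<length v. \<Sum>T\<in>cuts (count_list s' r) s.
        \<Sum>R\<in>cuts (length (substitute r f s' T)) (drop i v).
            F (\<lambda>c. (if f a = c then take (Suc i) v else []) @ gather c (substitute r f s' T) R))"
      by (intro sum.cong[OF refl] Cons.IH) (use Cons.prems other in auto)
    also have "\<dots> = (\<Sum>T\<in>cuts (count_list s' r) s. \<Sum>i<length v.
        \<Sum>R\<in>cuts (length (substitute r f s' T)) (drop i v).
            F (\<lambda>c. (if f a = c then take (Suc i) v else []) @ gather c (substitute r f s' T) R))"
      by (rule sum.swap)
    finally show ?thesis using other by (simp add: sum_cuts_Suc del: cuts.simps)
  next
    case last
    have fr: "f r \<in> L" using Cons.prems last by simp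
    have s_out: "gather c s Q = []" if "c \<notin> L" for c and Q :: "'x list list"
      using that Cons.prems(3) by (intro gather_notin) auto
    have out_s: "gather c (map f s') P = []" if "c \<in> L" for c and P :: "'x list list"
      using that Cons.prems(4) last by (intro gather_notin) auto
    \<comment> \<open>The first piece is not seen as a whole, since \<open>f r\<close> lies in
      \<open>L\<close>. The letters of \<open>s\<close> and the relabelled ones are disjoint, so the
      case distinction turns into concatenation.\<close>
    have *: "(\<lambda>c. if c \<in> L then gather c s Q else (if f a = c then p else []) @ gather c (map f s') P)
      = (\<lambda>c. gather c s Q @ gather c (map f s') P)" for Q P :: "'x list list" and p
    proof
      fix c
      show "(if c \<in> L then gather c s Q else (if f a = c then p else []) @ gather c (map f s') P)
        = gather c s Q @ gather c (map f s') P"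
        using fr s_out out_s last by auto
    qed
    have "(\<Sum>P\<in>cuts (length (a # s')) v. \<Sum>Q\<in>cuts (length s) (gather r (a # s') P).
            F (\<lambda>c. if c \<in> L then gather c s Q else gather c (map f (a # s')) P))
      = (\<Sum>i<length v. \<Sum>P\<in>cuts (length s') (drop i v). \<Sum>Q\<in>cuts (length s) (take (Suc i) v).
            F (\<lambda>c. gather c s Q @ gather c (map f s') P))"
      unfolding length_Cons sum_cuts_Suc using last * by (simp add: gather_notin cong: if_cong)
    also have "\<dots> = (\<Sum>i<length v. \<Sum>Q\<in>cuts (length s) (take (Suc i) v). \<Sum>P\<in>cuts (length s') (drop i v).
            F (\<lambda>c. gather c (s @ map f s') (Q @ P)))"
      by (subst sum.swap, intro sum.cong refl) (simp add: gather_append length_cuts)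
    also have "\<dots> = (\<Sum>R\<in>cuts (length (s @ map f s')) v. F (\<lambda>c. gather c (s @ map f s') R))"
      by (simp add: sum_cuts_add)
    \<comment> \<open>Here \<open>r\<close> occurs once, and \<open>[s]\<close> is the only cut of
      \<open>s\<close> into one run.\<close>
    finally show ?thesis
      using last Cons.prems by (simp add: sum_cuts_1 substitute_notin del: cuts.simps)
  next
    case inner
    have fr: "f r \<in> L" using Cons.prems inner by simp
    \<comment> \<open>The run \<open>take (Suc j) s\<close> belongs to the first interval and
      \<open>drop j s\<close> to the remaining ones. Outside \<open>L\<close> the first run
      contributes nothing, so it can stand in front.\<close>
    have *: "(\<lambda>c. if c \<in> L then gather c s (merge P1 Q) else (if f a = c then p else []) @ gather c (map f s') P)
      = (\<lambda>c. gather c (take (Suc j) s) P1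
          @ (if c \<in> L then gather c (drop j s) Q else gather c (map f s') P))"
      if "j < length s" "length P1 = Suc j" "length Q = length s - j" for Q P P1 :: "'x list list" and p j
    proof
      fix c
      have "gather c (take (Suc j) s) P1 = []" if "c \<notin> L"
        using that Cons.prems(3) by (intro gather_notin) (auto dest: in_set_takeD)
      then show "(if c \<in> L then gather c s (merge P1 Q) else (if f a = c then p else []) @ gather c (map f s') P)
        = gather c (take (Suc j) s) P1
          @ (if c \<in> L then gather c (drop j s) Q else gather c (map f s') P)"
        using fr inner that by (auto simp: gather_merge)
    qed
    have "(\<Sum>P\<in>cuts (length (a # s')) v. \<Sum>Q\<in>cuts (length s) (gather r (a # s') P).
            F (\<lambda>c. if c \<in> L then gather c s Q else gather c (map f (a # s')) P))
      = (\<Sum>i<length v. \<Sum>P\<in>cuts (length s') (drop i v).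
          \<Sum>Q\<in>cuts (length s) (take (Suc i) v @ gather r s' P).
            F (\<lambda>c. if c \<in> L then gather c s Q
                else (if f a = c then take (Suc i) v else []) @ gather c (map f s') P))"
      unfolding length_Cons sum_cuts_Suc using inner by (simp cong: if_cong)
    also have "\<dots> = (\<Sum>i<length v. \<Sum>P\<in>cuts (length s') (drop i v).
          \<Sum>j<length s. \<Sum>P1\<in>cuts (Suc j) (take (Suc i) v). \<Sum>Q\<in>cuts (length s - j) (gather r s' P).
            F (\<lambda>c. gather c (take (Suc j) s) P1
              @ (if c \<in> L then gather c (drop j s) Q else gather c (map f s') P)))"
    proof (intro sum.cong[OF refl])
      fix i P assume i: "i \<in> {..<length v}" and P: "P \<in> cuts (length s') (drop i v)"
      have g: "gather r s' P \<noteq> []"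
        using P inner by (intro gather_nonempty) (auto dest: length_cuts cuts_nonempty)
      have t: "take (Suc i) v \<noteq> []" using i by auto
      show "(\<Sum>Q\<in>cuts (length s) (take (Suc i) v @ gather r s' P).
            F (\<lambda>c. if c \<in> L then gather c s Q
                else (if f a = c then take (Suc i) v else []) @ gather c (map f s') P))
        = (\<Sum>j<length s. \<Sum>P1\<in>cuts (Suc j) (take (Suc i) v). \<Sum>Q\<in>cuts (length s - j) (gather r s' P).
            F (\<lambda>c. gather c (take (Suc j) s) P1
              @ (if c \<in> L then gather c (drop j s) Q else gather c (map f s') P)))"
        unfolding sum_cuts_append[OF t g]
        by (intro sum.cong[OF refl] arg_cong[where f = F] *)
           (auto dest: length_cuts simp del: cuts.simps)
    qed
    also have "\<dots> = (\<Sum>j<length s. \<Sum>i<length v. \<Sum>P1\<in>cuts (Suc j) (take (Suc i) v).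
          \<Sum>P\<in>cuts (length s') (drop i v). \<Sum>Q\<in>cuts (length (drop j s)) (gather r s' P).
            F (\<lambda>c. gather c (take (Suc j) s) P1
              @ (if c \<in> L then gather c (drop j s) Q else gather c (map f s') P)))"
      unfolding length_drop
      by (rule sum_swap_under)
    also have "\<dots> = (\<Sum>j<length s. \<Sum>i<length v. \<Sum>P1\<in>cuts (Suc j) (take (Suc i) v).
          \<Sum>T\<in>cuts (count_list s' r) (drop j s). \<Sum>R\<in>cuts (length (substitute r f s' T)) (drop i v).
            F (\<lambda>c. gather c (take (Suc j) s) P1 @ gather c (substitute r f s' T) R))"
      by (intro sum.cong[OF refl] Cons.IH) (use Cons.prems inner in \<open>auto dest: in_set_dropD\<close>)
    also have "\<dots> = (\<Sum>j<length s. \<Sum>T\<in>cuts (count_list s' r) (drop j s). \<Sum>i<length v.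
          \<Sum>P1\<in>cuts (Suc j) (take (Suc i) v). \<Sum>R\<in>cuts (length (substitute r f s' T)) (drop i v).
            F (\<lambda>c. gather c (take (Suc j) s) P1 @ gather c (substitute r f s' T) R))"
      by (intro sum.cong[OF refl] sum_swap_outer)
    \<comment> \<open>The cuts of the first interval and of the rest of \<open>v\<close> recombine
      to one cut of \<open>v\<close>, with \<open>Suc j\<close> pieces for the first run.\<close>
    also have "\<dots> = (\<Sum>j<length s. \<Sum>T\<in>cuts (count_list s' r) (drop j s).
          \<Sum>R\<in>cuts (Suc j + length (substitute r f s' T)) v.
            F (\<lambda>c. gather c (take (Suc j) s @ substitute r f s' T) R))"
      unfolding sum_cuts_add
      by (intro sum.cong[OF refl] arg_cong[where f = F] ext gather_append[symmetric])
         (auto dest: length_cuts simp del: cuts.simps)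
    \<comment> \<open>The sum over \<open>j\<close> is the choice of the first run in a cut of
      \<open>s\<close>.\<close>
    also have "\<dots> = (\<Sum>T\<in>cuts (count_list (a # s') r) s. \<Sum>R\<in>cuts (length (substitute r f (a # s') T)) v.
            F (\<lambda>c. gather c (substitute r f (a # s') T) R))"
    proof -
      have "count_list (a # s') r = Suc (count_list s' r)" using inner by simp
      then show ?thesis using inner
        by (simp add: sum_cuts_Suc[where n = "count_list s' r" and w = s] min_absorb2 Suc_leI
            del: cuts.simps)
    qed
    finally show ?thesis .
  qed
qed

section \<open>Index sequences and the two defining formulas\<close>

declare upt_Suc [simp del]

text \<open>
  The index sets of \<^const>\<open>phi_sur_basis\<close> and \<^const>\<open>sur_comp_basis\<close> are the cases
  \<open>a = 0\<close> and \<open>a = 1\<close>; the latter counts letters from \<open>1\<close>, so a dummy letter is put in front.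
\<close>

definition routes :: "nat \<Rightarrow> nat \<Rightarrow> nat \<Rightarrow> nat list set" where
  "routes a n d = {I. length I = Suc n \<and> I ! 0 = a \<and> I ! n = d \<and> sorted I}"

definition pieces :: "'x list \<Rightarrow> nat list \<Rightarrow> 'x list list" where
  "pieces v I = map (\<lambda>j. map ((!) v) [I ! j..<Suc (I ! Suc j)]) [0..<length I - 1]"

lemma routes_0: "routes a 0 d = (if a = d then {[a]} else {})"
  by (auto simp: routes_def length_Suc_conv)

lemma routes_Suc: "routes a (Suc n) d = (\<Union>b\<in>{a..d}. (#) a ` routes b n d)"
proof (intro set_eqI iffI)
  fix I assume "I \<in> routes a (Suc n) d"
  then obtain J where I: "I = a # J" and J: "length J = Suc n" "J ! n = d" "sorted (a # J)"
    by (cases I) (auto simp: routes_def)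
  then have "J ! 0 \<in> set J" "J ! n \<in> set J" by auto
  then have "a \<le> J ! 0" using J by auto
  moreover have "J ! 0 \<le> d" using J sorted_nth_mono[of J 0 n] by auto
  ultimately show "I \<in> (\<Union>b\<in>{a..d}. (#) a ` routes b n d)"
    using I J by (auto simp: routes_def)
next
  fix I assume "I \<in> (\<Union>b\<in>{a..d}. (#) a ` routes b n d)"
  then obtain b J where *: "a \<le> b" "b \<le> d" "I = a # J" "length J = Suc n" "J ! 0 = b" "J ! n = d" "sorted J"
    by (auto simp: routes_def)
  then have "\<forall>x\<in>set J. b \<le> x" by (cases J) auto
  then show "I \<in> routes a (Suc n) d" using * by (auto simp: routes_def)
qed

lemma finite_routes [simp]: "finite (routes a n d)"
proof (induction n arbitrary: a)
  case (Suc n)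
  then show ?case unfolding routes_Suc by (intro finite_UN_I finite_imageI) auto
qed (simp add: routes_0)

lemma sum_routes_Suc:
  fixes F :: "nat list \<Rightarrow> 'b :: comm_monoid_add"
  shows "(\<Sum>I\<in>routes a (Suc n) d. F I) = (\<Sum>b\<in>{a..d}. \<Sum>I\<in>routes b n d. F (a # I))"
proof -
  have "(\<Sum>I\<in>routes a (Suc n) d. F I) = (\<Sum>b\<in>{a..d}. \<Sum>I\<in>(#) a ` routes b n d. F I)"
    unfolding routes_Suc by (rule sum.UNION_disjoint) (simp_all, auto simp: routes_def)
  then show ?thesis by (simp add: sum.reindex)
qed

lemma pieces_Cons:
  assumes "J \<noteq> []"
  shows "pieces v (a # J) = map ((!) v) [a..<Suc (J ! 0)] # pieces v J"
proof -
  have "[0..<length J] = 0 # map Suc [0..<length J - 1]"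
    using assms by (metis Suc_pred' length_greater_0_conv map_Suc_upt upt_conv_Cons)
  then show ?thesis by (simp add: pieces_def)
qed

lemma map_nth_upt_drop:
  "a \<le> b \<Longrightarrow> b < length v \<Longrightarrow> map ((!) v) [a..<Suc b] = take (Suc (b - a)) (drop a v)"
  by (rule nth_equalityI) (auto)

text \<open>Successive entries of an index sequence are the ends of successive pieces. In the
  induction the end \<open>b\<close> of the first piece becomes the new starting point.\<close>

lemma sum_routes_pieces:
  fixes F :: "'x list list \<Rightarrow> 'b :: comm_monoid_add"
  assumes "a < length v"
  shows "(\<Sum>I\<in>routes a n (length v - 1). F (pieces v I)) = (\<Sum>P\<in>cuts n (drop a v). F P)"
  using assms
proof (induction n arbitrary: a F)
  case 0
  then show ?case by (auto simp: routes_0 pieces_def)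
next
  case (Suc n)
  have "(\<Sum>I\<in>routes a (Suc n) (length v - 1). F (pieces v I))
      = (\<Sum>b\<in>{a..length v - 1}. \<Sum>I\<in>routes b n (length v - 1).
          F (take (Suc (b - a)) (drop a v) # pieces v I))"
    unfolding sum_routes_Suc
  proof (intro sum.cong refl)
    fix b I assume *: "b \<in> {a..length v - 1}" "I \<in> routes b n (length v - 1)"
    then have "pieces v (a # I) = map ((!) v) [a..<Suc b] # pieces v I"
      by (subst pieces_Cons) (auto simp: routes_def)
    then show "F (pieces v (a # I)) = F (take (Suc (b - a)) (drop a v) # pieces v I)"
      using * Suc.prems by (subst (asm) map_nth_upt_drop) auto
  qed
  also have "\<dots> = (\<Sum>b\<in>{a..length v - 1}. \<Sum>P\<in>cuts n (drop b v).
          F (take (Suc (b - a)) (drop a v) # P))"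
    using Suc.prems
    by (intro sum.cong[OF refl] Suc.IH[where F = "\<lambda>P. F (take (Suc (_ - a)) (drop a v) # P)"]) auto
  also have "\<dots> = (\<Sum>i<length (drop a v). \<Sum>P\<in>cuts n (drop i (drop a v)).
          F (take (Suc i) (drop a v) # P))"
    using Suc.prems
    by (intro sum.reindex_bij_witness[of _ "\<lambda>i. i + a" "\<lambda>b. b - a"]) (auto simp: add.commute)
  finally show ?case unfolding sum_cuts_Suc .
qed

lemma gather_eq_concat:
  "length s \<le> length P \<Longrightarrow>
    gather c s P = concat (map ((!) P) (filter (\<lambda>i. s ! i = c) [0..<length s]))"
proof (induction c s P rule: gather.induct)
  case (1 c a s p P)
  have "[0..<length (a # s)] = 0 # map Suc [0..<length s]"
    by (simp add: upt_conv_Cons map_Suc_upt)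
  then show ?case using 1 by (simp add: filter_map o_def)
qed auto

lemma phi_sur_basis_eq:
  assumes "v \<noteq> []"
  shows "phi_sur_basis v m s w = (\<Sum>P\<in>cuts (length s) v.
    if \<forall>c\<in>{1..m}. distinct (gather c s P) then ind (map (\<lambda>c. gather c s P) [1..<Suc m]) w else 0)"
proof -
  define face where "face I r = concat (map (\<lambda>j. map (\<lambda>i. v ! i) [I ! (j - 1)..<Suc (I ! j)])
      (filter (\<lambda>j. s ! (j - 1) = r) [1..<Suc (length s)]))" for I r
  have face: "face I c = gather c s (pieces v I)" if "I \<in> routes 0 (length s) (length v - 1)" for I c
  proof -
    have len: "length I = Suc (length s)" using that by (simp add: routes_def)
    have "[1..<Suc (length s)] = map Suc [0..<length s]" by (simp add: map_Suc_upt)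
    then have "face I c = concat (map (\<lambda>j. map ((!) v) [I ! j..<Suc (I ! Suc j)])
      (filter (\<lambda>j. s ! j = c) [0..<length s]))"
      by (simp add: face_def filter_map o_def)
    also have "\<dots> = concat (map ((!) (pieces v I)) (filter (\<lambda>j. s ! j = c) [0..<length s]))"
      by (intro arg_cong[where f = concat] map_cong refl) (auto simp: pieces_def len)
    finally show ?thesis by (simp add: gather_eq_concat pieces_def len)
  qed
  have "phi_sur_basis v m s w = (\<Sum>I\<in>routes 0 (length s) (length v - 1).
      if \<forall>r\<in>{1..m}. distinct (face I r) then ind (map (face I) [1..<Suc m]) w else 0)"
    unfolding phi_sur_basis_def Let_def routes_def face_def by (rule refl)
  also have "\<dots> = (\<Sum>I\<in>routes 0 (length s) (length v - 1).
      if \<forall>c\<in>{1..m}. distinct (gather c s (pieces v I))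
      then ind (map (\<lambda>c. gather c s (pieces v I)) [1..<Suc m]) w else 0)"
    using face by (intro sum.cong refl) (simp cong: map_cong)
  finally show ?thesis using assms by (subst (asm) sum_routes_pieces) auto
qed

text \<open>Gives the recursion by positions, as in \<open>sur_comp_basis\<close>: an occurrence of
  \<open>r\<close> receives the run whose index is the number of earlier occurrences.\<close>

lemma substitute_eq_concat:
  "substitute r f s T = concat (map (\<lambda>p. if s ! p = r then T ! count_list (take p s) r else [f (s ! p)])
      [0..<length s])" if "count_list s r \<le> length T"
  using that
proof (induction s arbitrary: T)
  case (Cons a s)
  have *: "[0..<length (a # s)] = 0 # map Suc [0..<length s]"
    by (simp add: upt_conv_Cons map_Suc_upt)
  show ?case
  proof (cases "a = r")
    case True
    then obtain t T' where T: "T = t # T'" using Cons.prems by (cases T) auto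
    then show ?thesis using True Cons unfolding * by (simp add: o_def cong: if_cong)
  next
    case False
    then show ?thesis using Cons unfolding * by (simp add: o_def cong: if_cong)
  qed
qed simp

text \<open>Keeping \<open>r\<close> fixed puts it into the block \<open>{r..<r + m}\<close> of
  inserted letters, as \<open>sum_cuts_compose\<close> requires; larger letters are moved beyond
  that block.\<close>

definition relabel :: "nat \<Rightarrow> nat \<Rightarrow> nat \<Rightarrow> nat" where
  "relabel r m a = (if a \<le> r then a else a + (m - 1))"

lemma sum_cuts_map:
  fixes F :: "'y list list \<Rightarrow> 'b :: comm_monoid_add"
  shows "(\<Sum>P\<in>cuts n (map g w). F P) = (\<Sum>P\<in>cuts n w. F (map (map g) P))"
  by (induction n arbitrary: w F)
     (simp_all add: sum_cuts_0 sum_cuts_Suc take_map drop_map del: cuts.simps)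

lemma length_filter_less_positions:
  "length (filter (\<lambda>i. i < p) (filter (\<lambda>i. s ! (i - 1) = r) [1..<Suc (length s)]))
    = count_list (take (p - 1) s) r" if "p \<le> Suc (length s)"
proof -
  have *: "length (filter (\<lambda>i. s ! i = r) [0..<q]) = count_list (take q s) r" if "q \<le> length s" for q
    using that by (induction q) (auto simp: take_Suc_conv_app_nth upt_Suc)
  have "[1..<Suc (length s)] = map Suc [0..<length s]" by (simp add: map_Suc_upt)
  moreover have "filter (\<lambda>i. Suc i < p) (filter (\<lambda>i. s ! i = r) [0..<length s])
      = filter (\<lambda>i. s ! i = r) [0..<p - 1]"
  proof -
    have "[0..<length s] = [0..<p - 1] @ [p - 1..<length s]"
      using that by (metis diff_le_mono diff_Suc_1 le_add_diff_inverse upt_add_eq_append zero_le)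
    moreover have "filter (\<lambda>i. Suc i < p) [0..<p - 1] = [0..<p - 1]" by (rule filter_True) auto
    moreover have "filter (\<lambda>i. Suc i < p) [p - 1..<length s] = []" by (rule filter_False) auto
    ultimately have "filter (\<lambda>i. Suc i < p) [0..<length s] = [0..<p - 1]" by simp
    then show ?thesis by (metis (no_types, lifting) filter_filter conj_commute filter_cong)
  qed
  ultimately show ?thesis using that * by (simp add: filter_map o_def)
qed

text \<open>An index sequence \<open>js\<close> cuts \<open>s\<close> into overlapping runs, one for
  each occurrence of \<open>r\<close>. Shifting letters commutes with cutting
  (\<open>sum_cuts_map\<close>), so the shift can be applied to \<open>s\<close> beforehand.\<close>

lemma sur_comp_basis_eq:
  assumes "s \<noteq> []"
  shows "sur_comp_basis s' r m s w = (\<Sum>T\<in>cuts (count_list s' r) (map (\<lambda>a. a + (r - 1)) s).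
    ind (substitute r (relabel r m) s' T) w)"
proof -
  define g where "g = (\<lambda>a. a + (r - 1))"
  define k where "k = count_list s' r"
  define pos where "pos = filter (\<lambda>i. s' ! (i - 1) = r) [1..<Suc (length s')]"
  have "filter (\<lambda>i. i < Suc (length s')) pos = pos"
    by (auto simp: pos_def intro!: filter_cong)
  then have k: "length pos = k"
    using length_filter_less_positions[of "Suc (length s')" s' r]
    by (simp add: pos_def k_def)
  define build where "build js = concat (map (\<lambda>p.
            if s' ! (p - 1) = r then
              (let t = length (filter (\<lambda>i. i < p) pos) + 1 in
               map (\<lambda>j. s ! (j - 1) + (r - 1)) [js ! (t - 1)..<Suc (js ! t)])
            else if s' ! (p - 1) < r then [s' ! (p - 1)]
            else [s' ! (p - 1) + (m - 1)]) [1..<Suc (length s')])" for js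
  have build: "build js = substitute r (relabel r m) s' (map (map g) (pieces (undefined # s) js))"
    if "js \<in> routes 1 k (length s)" for js
  proof -
    have len: "length js = Suc k" and js1: "\<forall>x\<in>set js. 1 \<le> x"
      using that by (cases js; force simp: routes_def)+
    have lp: "length (pieces (undefined # s) js) = k" by (simp add: pieces_def len)
    have shift: "[1..<Suc (length s')] = map Suc [0..<length s']" by (simp add: map_Suc_upt)
    have "build js = concat (map (\<lambda>p. if s' ! p = r then
          map (map g) (pieces (undefined # s) js) ! count_list (take p s') r
        else [relabel r m (s' ! p)]) [0..<length s'])"
      unfolding build_def shift map_map o_def
    proof (intro arg_cong[where f = concat] map_cong refl)
      fix p assume p: "p \<in> set [0..<length s']"
      let ?c = "count_list (take p s') r"
      have t: "length (filter (\<lambda>i. i < Suc p) pos) = ?c"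
        using p length_filter_less_positions[of "Suc p" s' r] by (simp add: pos_def)
      have "map (\<lambda>j. s ! (j - 1) + (r - 1)) [js ! ?c..<Suc (js ! Suc ?c)]
          = map (map g) (pieces (undefined # s) js) ! ?c" if "s' ! p = r"
      proof -
        have "s' = take p s' @ r # drop (Suc p) s'" using p that by (auto simp: id_take_nth_drop)
        then have "k = ?c + Suc (count_list (drop (Suc p) s') r)"
          unfolding k_def by (metis count_list_append count_list.simps(2) add_Suc_right Suc_eq_plus1)
        then have c: "?c < k" by simp
        \<comment> \<open>All indices are at least 1, so the dummy letter at position 0 is never
          read.\<close>
        then have "1 \<le> js ! ?c" using js1 len by simp
        then show ?thesis using c lp len
          by (auto simp: pieces_def g_def nth_Cons')
      qed
      then show "(if s' ! (Suc p - 1) = r then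
              (let t = length (filter (\<lambda>i. i < Suc p) pos) + 1 in
               map (\<lambda>j. s ! (j - 1) + (r - 1)) [js ! (t - 1)..<Suc (js ! t)])
            else if s' ! (Suc p - 1) < r then [s' ! (Suc p - 1)]
            else [s' ! (Suc p - 1) + (m - 1)])
        = (if s' ! p = r then map (map g) (pieces (undefined # s) js) ! ?c
           else [relabel r m (s' ! p)])"
        using t by (simp add: relabel_def Let_def)
    qed
    then show ?thesis by (simp add: substitute_eq_concat lp k_def)
  qed
  have "sur_comp_basis s' r m s w = (\<Sum>js\<in>routes 1 k (length s). ind (build js) w)"
    unfolding sur_comp_basis_def routes_def k[symmetric] build_def pos_def
    unfolding Let_def by (rule refl)
  also have "\<dots> = (\<Sum>js\<in>routes 1 k (length (undefined # s) - 1).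
      ind (substitute r (relabel r m) s' (map (map g) (pieces (undefined # s) js))) w)"
    using build by (intro sum.cong) auto
  also have "\<dots> = (\<Sum>T\<in>cuts k s. ind (substitute r (relabel r m) s' (map (map g) T)) w)"
    using assms by (subst sum_routes_pieces) auto
  finally show ?thesis unfolding g_def k_def sum_cuts_map by simp
qed

subsection \<open>Evaluation of surjection-like elements\<close>

lemma set_take_drop: "i < length w \<Longrightarrow> set (take (Suc i) w) \<union> set (drop i w) = set w"
proof -
  have "set w = set (take i w) \<union> set (drop i w)" by (metis append_take_drop_id set_append)
  moreover have "set (take i w) \<subseteq> set (take (Suc i) w)" by (rule set_take_subset_set_take) simp
  ultimately show ?thesis by (auto dest: in_set_takeD)
qed

lemma sorted_take_drop:
  assumes "sorted v" "x \<in> set (take (Suc i) v)" "y \<in> set (drop i v)"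
  shows "x \<le> y"
proof -
  obtain a where "a < length v" "a \<le> i" "x = v ! a"
    using assms(2) by (auto simp: in_set_conv_nth less_Suc_eq_le)
  moreover obtain b where "b < length (drop i v)" "y = drop i v ! b"
    using assms(3) by (metis in_set_conv_nth)
  ultimately show ?thesis using assms(1) by (auto intro: sorted_nth_mono)
qed

lemma sorted_gather_cuts:
  assumes "P \<in> cuts (length s) v" "sorted v"
  shows "sorted (gather c s P)"
proof -
  \<comment> \<open>The inclusion is carried through the induction because it bounds the later
    entries from below by those of the first piece.\<close>
  have "set (gather c s P) \<subseteq> set v \<and> (sorted v \<longrightarrow> sorted (gather c s P))"
    using assms(1)
  proof (induction s arbitrary: v P)
    case (Cons a s)
    then obtain i P' where P: "i < length v" "P = take (Suc i) v # P'" "P' \<in> cuts (length s) (drop i v)"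
      by auto
    from Cons.IH[OF P(3)] have *: "set (gather c s P') \<subseteq> set (drop i v)"
      "sorted v \<Longrightarrow> sorted (gather c s P')"
      by (auto intro: sorted_wrt_drop)
    then have "set (gather c s P') \<subseteq> set v" by (auto dest: in_set_dropD)
    moreover have "sorted (take (Suc i) v @ gather c s P')" if "sorted v"
      using * that sorted_take_drop[OF that] by (auto simp: sorted_append sorted_wrt_take)
    ultimately show ?case using * by (auto simp: P(2) dest: in_set_takeD)
  qed simp
  then show ?thesis using assms(2) by blast
qed

text \<open>In a sorted list a repetition can be found at neighbouring positions, and these lie in a
  common piece.\<close>

lemma distinct_if_pieces_distinct:
  assumes "P \<in> cuts n w" "sorted (w :: 'x :: linorder list)" "\<And>p. p \<in> set P \<Longrightarrow> distinct p"
  shows "distinct w"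
  using assms
proof (induction n arbitrary: w P)
  case 0
  then show ?case by (cases w) (auto split: if_splits)
next
  case (Suc n)
  then obtain i P' where P: "i < length w" "P = take (Suc i) w # P'" "P' \<in> cuts n (drop i w)"
    by auto
  have "distinct (drop i w)"
    using Suc.IH[OF P(3)] Suc.prems P(2) by (auto intro: sorted_wrt_drop)
  then have 1: "sorted_wrt (<) (w ! i # drop (Suc i) w)"
    using Suc.prems P(1) by (simp add: Cons_nth_drop_Suc strict_sorted_iff sorted_wrt_drop)
  have 2: "sorted_wrt (<) (take i w @ [w ! i])"
    using Suc.prems P by (simp add: take_Suc_conv_app_nth[symmetric] strict_sorted_iff sorted_wrt_take)
  have "sorted_wrt (<) (take i w @ w ! i # drop (Suc i) w)"
    using 1 2 by (auto simp: sorted_wrt_append intro: less_trans)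
  then show ?case using P(1) by (simp add: id_take_nth_drop[symmetric] strict_sorted_iff)
qed

lemma distinct_pieces_if_gather:
  "length s = length P \<Longrightarrow> (\<And>c. c \<in> set s \<Longrightarrow> distinct (gather c s P)) \<Longrightarrow> p \<in> set P \<Longrightarrow> distinct p"
proof (induction s P rule: list_induct2)
  case (Cons a s q P)
  have "distinct (gather c s P)" if "c \<in> set s" for c
    using Cons.prems(1)[of c] that by (auto split: if_splits)
  then show ?case using Cons.IH Cons.prems(1)[of a] Cons.prems(2) by auto
qed simp

section \<open>Linear extension over F_2\<close>

lemma lin_eq:
  assumes "finite U" "supp v \<subseteq> U"
  shows "lin f v w = (\<Sum>u\<in>U. v u * f u w)"
  unfolding lin_def using assms by (intro sum.mono_neutral_left) (auto simp: supp_def)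

lemma supp_ind [simp]: "supp (ind x) = {x}"
  by (auto simp: supp_def ind_def)

lemma lin_ind [simp]: "lin f (ind x) = f x"
  by (simp only: lin_def supp_ind sum.insert finite.emptyI empty_iff not_False_eq_True sum.empty
      add_0_right) (simp only: ind_def simp_thms if_True mult_1_left)

lemma supp_sum: "supp (\<lambda>w. \<Sum>i\<in>A. h i w) \<subseteq> (\<Union>i\<in>A. supp (h i))"
proof
  fix u assume "u \<in> supp (\<lambda>w. \<Sum>i\<in>A. h i w)"
  then obtain i where "i \<in> A" "h i u \<noteq> 0"
    unfolding supp_def using sum.not_neutral_contains_not_neutral by blast
  then show "u \<in> (\<Union>i\<in>A. supp (h i))" unfolding supp_def by blast
qed

lemma finite_supp_sum:
  "finite A \<Longrightarrow> (\<And>i. i \<in> A \<Longrightarrow> finite (supp (h i))) \<Longrightarrow> finite (supp (\<lambda>w. \<Sum>i\<in>A. h i w))"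
  by (rule finite_subset[OF supp_sum]) auto

lemma lin_sum:
  assumes "finite A" "\<And>i. i \<in> A \<Longrightarrow> finite (supp (h i))"
  shows "lin f (\<lambda>w. \<Sum>i\<in>A. h i w) w = (\<Sum>i\<in>A. lin f (h i) w)"
proof -
  let ?U = "\<Union>i\<in>A. supp (h i)"
  have U: "finite ?U" using assms by auto
  have "lin f (\<lambda>w. \<Sum>i\<in>A. h i w) w = (\<Sum>u\<in>?U. \<Sum>i\<in>A. h i u * f u w)"
    by (simp only: lin_eq[OF U supp_sum] sum_distrib_right)
  also have "\<dots> = (\<Sum>i\<in>A. lin f (h i) w)"
    by (subst sum.swap, rule sum.cong[OF refl], rule lin_eq[OF U, symmetric]) auto
  finally show ?thesis .
qed

lemma lin_zero [simp]: "lin f (\<lambda>_. 0) w = 0"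
  by (simp add: lin_def supp_def)

lemma lin_sum_ind: "finite A \<Longrightarrow> lin f (\<lambda>w. \<Sum>i\<in>A. ind (g i) w) w = (\<Sum>i\<in>A. f (g i) w)"
  by (subst lin_sum) auto

lemma lin_sum_ind_if:
  assumes "finite A"
  shows "lin f (\<lambda>w. \<Sum>i\<in>A. if c i then ind (g i) w else 0) w = (\<Sum>i\<in>A. if c i then f (g i) w else 0)"
  unfolding sum.inter_filter[OF assms, symmetric] using assms by (simp add: lin_sum_ind)

text \<open>The tensor product of two basis tensors. The position \<open>b\<close> at which
  \<open>tens\<close> splits the output has to be the arity of the first factor.\<close>

lemma ind_append:
  assumes "length x = b"
  shows "ind x (take b w) * ind y (drop b w) = ind (x @ y) w"
proof -
  have "w = x @ y \<longleftrightarrow> take b w = x \<and> drop b w = y"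
    using assms by (metis append_eq_conv_conj)
  then show ?thesis by (simp add: ind_def)
qed

section \<open>Iterated diagonal, iterated join and surjection-like elements\<close>

lemma aw_iter_eq:
  "v \<noteq> [] \<Longrightarrow> aw_iter (Suc n) [v] w = (\<Sum>P\<in>cuts (Suc n) v. ind P w)"
proof (induction n arbitrary: v w)
  case 0
  show ?case unfolding sum_cuts_1[OF 0] by (simp add: idm_def)
next
  case (Suc n)
  let ?T = "tens 1 (Suc n) (aw_iter (Suc n)) idm"
  have "aw_iter (Suc (Suc n)) [v] w = lin ?T (aw [v]) w"
    by (simp add: compose_def)
  also have "\<dots> = (\<Sum>i<length v. ?T [take (Suc i) v, drop i v] w)"
    unfolding aw_def by (simp add: lin_sum_ind)
  also have "\<dots> = (\<Sum>i<length v. \<Sum>P\<in>cuts (Suc n) (take (Suc i) v). ind (P @ [drop i v]) w)"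
  proof (intro sum.cong refl)
    fix i assume "i \<in> {..<length v}"
    then have "aw_iter (Suc n) [take (Suc i) v] u = (\<Sum>P\<in>cuts (Suc n) (take (Suc i) v). ind P u)" for u
      by (intro Suc.IH) auto
    note IH = this
    have "?T [take (Suc i) v, drop i v] w
        = aw_iter (Suc n) [take (Suc i) v] (take (Suc n) w) * ind [drop i v] (drop (Suc n) w)"
      by (simp add: tens_def idm_def del: aw_iter.simps)
    also have "\<dots> = (\<Sum>P\<in>cuts (Suc n) (take (Suc i) v).
        ind P (take (Suc n) w) * ind [drop i v] (drop (Suc n) w))"
      unfolding IH by (rule sum_distrib_right)
    also have "\<dots> = (\<Sum>P\<in>cuts (Suc n) (take (Suc i) v). ind (P @ [drop i v]) w)"
      by (intro sum.cong refl ind_append) (rule length_cuts)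
    finally show "?T [take (Suc i) v, drop i v] w = \<dots>" .
  qed
  \<comment> \<open>The iterated diagonal splits off its last piece first, whereas
    \<open>cuts\<close> begins with the first piece; \<open>sum_cuts_add\<close> with one final
    piece reconciles the two.\<close>
  also have "\<dots> = (\<Sum>P\<in>cuts (Suc n + Suc 0) v. ind P w)"
    unfolding sum_cuts_add by (intro sum.cong refl sum_cuts_1[symmetric]) auto
  finally show ?case by simp
qed

text \<open>The concatenation is already increasing, so the sorting in \<open>join\<close> is the
  identity. Distinctness of the single factors is assumed because the first iterate is the identity
  and tests nothing.\<close>

lemma mu_iter_eq:
  "length u = Suc k \<Longrightarrow> sorted (concat u) \<Longrightarrow> (\<And>p. p \<in> set u \<Longrightarrow> distinct p) \<Longrightarrow>
    mu_iter (Suc k) u w = (if distinct (concat u) then ind [concat u] w else 0)"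
proof (induction k arbitrary: u w)
  case 0
  then obtain x where "u = [x]" by (auto simp: length_Suc_conv)
  then show ?case using 0 by (simp add: idm_def)
next
  case (Suc k)
  then obtain u' x where u: "u = u' @ [x]" "length u' = Suc k" by (cases u rule: rev_cases) auto
  have "mu_iter (Suc k) u' w = (if distinct (concat u') then ind [concat u'] w else 0)" for w
    using Suc.prems by (intro Suc.IH) (auto simp: u sorted_append)
  note IH = this
  have t: "tens (Suc k) 1 (mu_iter (Suc k)) idm u
    = (\<lambda>w. if distinct (concat u') then ind [concat u', x] w else 0)"
    using ind_append[of "[concat u']" 1 _ "[x]"]
    by (auto simp: fun_eq_iff tens_def u IH idm_def simp del: mu_iter.simps)
  have "mu_iter (Suc (Suc k)) u w = lin join (tens (Suc k) 1 (mu_iter (Suc k)) idm u) w"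
    by (simp add: compose_def)
  also have "\<dots> = (if distinct (concat u) then ind [concat u] w else 0)"
    unfolding t using Suc.prems(2)
    by (cases "distinct (concat u')") (auto simp: join_def u sorted_sort_id)
  finally show ?case .
qed

text \<open>The list \<open>b r\<close> holds the inputs of the join with output \<open>r\<close>.
  It must be nonempty, since \<open>mu_iter 0\<close> is a placeholder; surjectivity of the sequence
  will guarantee this.\<close>

lemma mus_eq:
  assumes "\<And>r. r \<in> set rs \<Longrightarrow> b r \<noteq> [] \<and> sorted (concat (b r)) \<and> (\<forall>p\<in>set (b r). distinct p)"
  shows "mus (map (\<lambda>r. length (b r)) rs) (concat (map b rs)) w
    = (if \<forall>r\<in>set rs. distinct (concat (b r)) then ind (map (\<lambda>r. concat (b r)) rs) w else 0)"
  using assms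
proof (induction rs arbitrary: w)
  case Nil
  then show ?case by (simp add: idm_def)
next
  case (Cons r rs)
  have IH: "mus (map (\<lambda>r. length (b r)) rs) (concat (map b rs)) w
    = (if \<forall>r\<in>set rs. distinct (concat (b r)) then ind (map (\<lambda>r. concat (b r)) rs) w else 0)" for w
    using Cons.prems by (intro Cons.IH) auto
  obtain k where k: "length (b r) = Suc k" using Cons.prems[of r] by (cases "b r") auto
  have mu: "mu_iter (length (b r)) (b r) w
      = (if distinct (concat (b r)) then ind [concat (b r)] w else 0)" for w
    unfolding k using Cons.prems[of r] by (intro mu_iter_eq[OF k]) auto
  have "mus (map (\<lambda>r. length (b r)) (r # rs)) (concat (map b (r # rs))) w
    = mu_iter (length (b r)) (b r) (take 1 w)
      * mus (map (\<lambda>r. length (b r)) rs) (concat (map b rs)) (drop 1 w)"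
    by (simp add: tens_def)
  then show ?case
    unfolding mu IH using ind_append[of "[concat (b r)]" 1 w "map (\<lambda>r. concat (b r)) rs"] by auto
qed

lemma strict_sorted_gather_cuts:
  assumes "P \<in> cuts (length s) v" "sorted v" "distinct (gather c s P)"
  shows "sorted_wrt (<) (gather c s P)"
  using sorted_gather_cuts[OF assms(1,2)] assms(3) by (simp add: strict_sorted_iff)

lemma distinct_cuts: "P \<in> cuts n v \<Longrightarrow> distinct v \<Longrightarrow> p \<in> set P \<Longrightarrow> distinct p"
  by (induction n arbitrary: v P) (auto split: if_splits)

text \<open>The iterated diagonal yields all cuts, \<open>tau\<close> sorts the pieces by label, and
  the joins concatenate each block, giving zero when a vertex repeats.\<close>

lemma surjlike_eq:
  assumes "set s = {1..m}" "s \<noteq> []" "v \<noteq> []" "sorted_wrt (<) v"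
  shows "surjlike m s [v] w = phi_sur_basis v m s w"
proof -
  obtain n where n: "length s = Suc n" using assms(2) by (cases s) auto
  define b where "b P r = map ((!) P) (filter (\<lambda>i. s ! i = r) [0..<length s])" for P :: "nat list list" and r
  define ks where "ks = map (\<lambda>r. length (filter (\<lambda>x. x = r) s)) [1..<Suc m]"
  have ks: "ks = map (\<lambda>r. length (b P r)) [1..<Suc m]" for P
  proof -
    have "filter (\<lambda>x. x = r) s = map ((!) s) (filter (\<lambda>i. s ! i = r) [0..<length s])" for r
      using filter_map[of "\<lambda>x. x = r" "(!) s" "[0..<length s]"] by (simp add: map_nth o_def)
    then show ?thesis by (simp add: ks_def b_def)
  qed
  have gather: "concat (b P r) = gather r s P" if "P \<in> cuts (length s) v" for P r
    using length_cuts[OF that] by (simp add: gather_eq_concat b_def)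
  have "aw_iter (length s) [v] = (\<lambda>w. \<Sum>P\<in>cuts (length s) v. ind P w)"
    unfolding n by (rule ext) (rule aw_iter_eq[OF assms(3)])
  then have "compose (tau m s) (aw_iter (length s)) [v]
      = (\<lambda>w. \<Sum>P\<in>cuts (length s) v. ind (tau_perm m s P) w)"
    by (intro ext) (simp only: compose_def tau_def lin_sum_ind[OF finite_cuts])
  then have "surjlike m s [v] w = (\<Sum>P\<in>cuts (length s) v. mus ks (tau_perm m s P) w)"
    unfolding surjlike_def ks_def[symmetric] by (simp add: compose_def[of "mus ks"] lin_sum_ind)
  also have "\<dots> = (\<Sum>P\<in>cuts (length s) v. if \<forall>r\<in>{1..m}. distinct (gather r s P)
      then ind (map (\<lambda>r. gather r s P) [1..<Suc m]) w else 0)"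
  proof (intro sum.cong refl)
    fix P assume P: "P \<in> cuts (length s) v"
    have "b P r \<noteq> [] \<and> sorted (concat (b P r)) \<and> (\<forall>p\<in>set (b P r). distinct p)"
      if "r \<in> set [1..<Suc m]" for r
    proof (intro conjI ballI)
      have "r \<in> set s" using that assms(1) by auto
      then show "b P r \<noteq> []" by (auto simp: b_def filter_empty_conv in_set_conv_nth)
      show "sorted (concat (b P r))"
        using sorted_gather_cuts[OF P] assms(4) by (simp add: gather[OF P] strict_sorted_iff)
      fix p assume "p \<in> set (b P r)"
      then have "p \<in> set P" using length_cuts[OF P] by (auto simp: b_def)
      then show "distinct p" using distinct_cuts[OF P] assms(4) by (simp add: strict_sorted_iff)
    qed
    then have "mus ks (concat (map (b P) [1..<Suc m])) w
      = (if \<forall>r\<in>set [1..<Suc m]. distinct (concat (b P r)) then ind (map (\<lambda>r. concat (b P r)) [1..<Suc m]) w else 0)"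
      unfolding ks[of P] by (intro mus_eq)
    moreover have "tau_perm m s P = concat (map (b P) [1..<Suc m])"
      by (simp add: tau_perm_def b_def[abs_def])
    moreover have "set [1..<Suc m] = {1..m}" by auto
    ultimately show "mus ks (tau_perm m s P) w = (if \<forall>r\<in>{1..m}. distinct (gather r s P)
      then ind (map (\<lambda>r. gather r s P) [1..<Suc m]) w else 0)"
      by (simp only: gather[OF P])
  qed
  finally show ?thesis by (simp only: phi_sur_basis_eq[OF assms(3)])
qed

section \<open>Surjectivity under substitution\<close>

lemma set_cuts: "T \<in> cuts n w \<Longrightarrow> n \<noteq> 0 \<Longrightarrow> (\<Union>t\<in>set T. set t) = set w"
proof (induction n arbitrary: w T)
  case (Suc n)
  then obtain i T' where T: "i < length w" "T = take (Suc i) w # T'" "T' \<in> cuts n (drop i w)"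
    by auto
  show ?case
  proof (cases "n = 0")
    case True
    then show ?thesis using T by (auto split: if_splits)
  next
    case False
    then show ?thesis using Suc.IH[OF T(3)] set_take_drop[OF T(1)] T(2) by simp
  qed
qed simp

lemma set_substitute:
  "length T = count_list s r \<Longrightarrow> set (substitute r f s T) = f ` (set s - {r}) \<union> (\<Union>t\<in>set T. set t)"
proof (induction s arbitrary: T)
  case (Cons a s)
  then show ?case by (cases T) auto
qed auto

text \<open>The invariant of the induction over trees. Surjectivity makes the face to be cut further
  nonempty and brings every piece into some tested face in \<open>compose_faces\<close>.\<close>

definition surj_combination :: "nat \<Rightarrow> nat list vec \<Rightarrow> bool" where
  "surj_combination m z \<longleftrightarrow> finite (supp z) \<and> (\<forall>s\<in>supp z. s \<noteq> [] \<and> set s = {1..m})"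

lemma set_substitute_relabel:
  assumes "set s' = {1..m'}" "set s = {1..m}" "m \<ge> 1" "1 \<le> r" "r \<le> m'"
    and T: "T \<in> cuts (count_list s' r) (map (\<lambda>a. a + (r - 1)) s)"
  shows "set (substitute r (relabel r m) s' T) = {1..m' + m - 1}"
proof -
  have "count_list s' r \<noteq> 0" using assms by (simp add: count_list_0_iff)
  then have "set (substitute r (relabel r m) s' T)
      = relabel r m ` ({1..m'} - {r}) \<union> (\<lambda>a. a + (r - 1)) ` {1..m}"
    using set_substitute[OF length_cuts[OF T]] set_cuts[OF T] assms by simp
  also have "(\<lambda>a. a + (r - 1)) ` {1..m} = {r..<r + m}"
    using assms(4) image_add_atLeastAtMost'[of "r - 1" 1 m] by auto
  also have "relabel r m ` ({1..m'} - {r}) = {1..<r} \<union> {r + m..m' + m - 1}"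
  proof (intro set_eqI iffI)
    fix x assume "x \<in> {1..<r} \<union> {r + m..m' + m - 1}"
    then have "x = relabel r m (if x < r then x else x - (m - 1))"
      "(if x < r then x else x - (m - 1)) \<in> {1..m'} - {r}"
      using assms by (auto simp: relabel_def)
    then show "x \<in> relabel r m ` ({1..m'} - {r})" by blast
  qed (use assms in \<open>auto simp: relabel_def\<close>)
  finally show ?thesis using assms by auto
qed

subsection \<open>Compatibility with operadic composition\<close>

lemma map_add_upt_shift: "map (\<lambda>c. c + k) [a..<b] = [a + k..<b + k]"
  by (rule nth_equalityI) auto

text \<open>The composite of the chain maps tests the \<open>r\<close>-th face as a whole before
  cutting it; the substituted sequence tests only the \<open>m\<close> faces made from it. The
  second claim says that this is the same condition.\<close>

lemma compose_faces:
  assumes s': "set s' = {1..m'}" and s: "set s = {1..m}" "m \<ge> 1" and r: "1 \<le> r" "r \<le> m'"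
    and v: "sorted v"
    and P: "P \<in> cuts (length s') v" and Q: "Q \<in> cuts (length s) (gather r s' P)"
  defines "A \<equiv> \<lambda>c. if c \<in> {r..<r + m} then gather c (map (\<lambda>a. a + (r - 1)) s) Q
                   else gather c (map (relabel r m) s') P"
    and "U \<equiv> map (\<lambda>c. gather c s' P) [1..<Suc m']"
    and "V \<equiv> map (\<lambda>c. gather c s Q) [1..<Suc m]"
  shows "map A [1..<Suc (m' + m - 1)] = take (r - 1) U @ V @ drop r U"
    and "(\<forall>c\<in>{1..m' + m - 1}. distinct (A c)) \<longleftrightarrow>
        (\<forall>c\<in>{1..m'}. distinct (gather c s' P)) \<and> (\<forall>c\<in>{1..m}. distinct (gather c s Q))"
proof -
  have "[1..<Suc (m' + m - 1)] = [1..<r] @ [r..<r + m] @ [r + m..<m' + m]"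
  proof -
    have "Suc (m' + m - 1) = m' + m" using s by simp
    moreover have "[1..<m' + m] = [1..<r] @ [r..<m' + m]"
      using upt_add_eq_append[of 1 r "m' + m - r"] r by simp
    moreover have "[r..<m' + m] = [r..<r + m] @ [r + m..<m' + m]"
      using upt_add_eq_append[of r "r + m" "m' - r"] r by (simp add: add.commute)
    ultimately show ?thesis by simp
  qed
  moreover have "map A [1..<r] = take (r - 1) U"
  proof -
    have "A c = gather c s' P" if "c < r" for c
      using that gather_map_inj[of s' "relabel r m" c P] by (auto simp: A_def relabel_def)
    then show ?thesis using r by (simp add: U_def take_map take_upt)
  qed
  moreover have "map A [r..<r + m] = V"
  proof -
    have "A (c + (r - 1)) = gather c s Q" if "1 \<le> c" "c \<le> m" for c
    proof -
      have "gather (c + (r - 1)) (map (\<lambda>a. a + (r - 1)) s) Q = gather c s Q"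
        by (rule gather_map_inj[where f = "\<lambda>a. a + (r - 1)"]) (simp only: add_right_cancel)
      moreover have "c + (r - 1) \<in> {r..<r + m}" using that r by auto
      ultimately show ?thesis by (simp only: A_def if_True)
    qed
    moreover have "[r..<r + m] = map (\<lambda>c. c + (r - 1)) [1..<Suc m]"
    proof -
      have "1 + (r - 1) = r" "Suc m + (r - 1) = r + m" using r by auto
      then show ?thesis by (simp only: map_add_upt_shift)
    qed
    ultimately show ?thesis by (simp add: V_def)
  qed
  moreover have "map A [r + m..<m' + m] = drop r U"
  proof -
    have "A (c + (m - 1)) = gather c s' P" if "r < c" for c
    proof -
      have "relabel r m c = c + (m - 1)" using that by (simp add: relabel_def)
      moreover have "gather (relabel r m c) (map (relabel r m) s') P = gather c s' P"
        using that by (intro gather_map_inj) (auto simp: relabel_def)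
      moreover have "c + (m - 1) \<notin> {r..<r + m}" using that s by auto
      ultimately show ?thesis by (simp only: A_def if_False)
    qed
    moreover have "[r + m..<m' + m] = map (\<lambda>c. c + (m - 1)) [Suc r..<Suc m']"
    proof -
      have "Suc r + (m - 1) = r + m" "Suc m' + (m - 1) = m' + m" using s by auto
      then show ?thesis by (simp only: map_add_upt_shift)
    qed
    ultimately show ?thesis by (simp add: U_def drop_map drop_upt)
  qed
  ultimately show map_A: "map A [1..<Suc (m' + m - 1)] = take (r - 1) U @ V @ drop r U" by simp
  have all: "(\<forall>c\<in>{1..k}. distinct (h c)) \<longleftrightarrow> list_all distinct (map h [1..<Suc k])" for h :: "nat \<Rightarrow> 'a list" and k
    by (auto simp: list_all_iff)
  have "length U = m'" by (simp add: U_def)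
  then have "U = take (r - 1) U @ U ! (r - 1) # drop r U"
    using id_take_nth_drop[of "r - 1" U] r by simp
  then have U: "list_all distinct U \<longleftrightarrow>
      list_all distinct (take (r - 1) U) \<and> distinct (U ! (r - 1)) \<and> list_all distinct (drop r U)"
    by (metis list_all_append list.pred_inject(2))
  \<comment> \<open>Every piece of \<open>Q\<close> is part of one of the new faces, so the pieces
    are distinct. The \<open>r\<close>-th face is sorted, and a repetition in it would show up
    inside a piece.\<close>
  have "distinct (U ! (r - 1))" if "list_all distinct V"
  proof -
    have "\<forall>c\<in>{1..m}. distinct (gather c s Q)" using that by (auto simp: V_def list_all_iff)
    then have "distinct p" if "p \<in> set Q" for p
      using s(1) length_cuts[OF Q] by (intro distinct_pieces_if_gather[OF _ _ that]) auto
    then have "distinct (gather r s' P)"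
      by (rule distinct_if_pieces_distinct[OF Q sorted_gather_cuts[OF P v]])
    then show ?thesis using r nth_upt[of 1 "r - 1" "Suc m'"] by (simp add: U_def)
  qed
  then show "(\<forall>c\<in>{1..m' + m - 1}. distinct (A c)) \<longleftrightarrow>
        (\<forall>c\<in>{1..m'}. distinct (gather c s' P)) \<and> (\<forall>c\<in>{1..m}. distinct (gather c s Q))"
    unfolding all map_A U_def[symmetric] V_def[symmetric] list_all_append U by blast
qed

lemma sum_if_conj:
  "(\<Sum>x\<in>A. if C \<and> D x then h x else 0) = (if C then \<Sum>x\<in>A. if D x then h x else 0 else 0)"
  by (cases C) simp_all

lemma sum_if_outer:
  "(\<Sum>x\<in>A. if C then h x else 0) = (if C then \<Sum>x\<in>A. h x else 0)"
  by (cases C) simp_all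

text \<open>Compatibility for a pair of single sequences. The left side applies the operation of
  \<open>s\<close> in slot \<open>r\<close> to the output of that of \<open>s'\<close>; the right
  side sums over the summands of the composed sequence.\<close>

lemma phi_sur_basis_compose:
  assumes s': "set s' = {1..m'}" and s: "set s = {1..m}" "m \<ge> 1" and r: "1 \<le> r" "r \<le> m'"
    and v: "v \<noteq> []" "sorted_wrt (<) v"
  shows "(\<Sum>P\<in>cuts (length s') v. if \<forall>c\<in>{1..m'}. distinct (gather c s' P)
      then tens (r - 1) (r - 1) idm (tens 1 m (\<lambda>u. phi_sur_basis (hd u) m s) idm)
        (map (\<lambda>c. gather c s' P) [1..<Suc m']) w else 0)
    = (\<Sum>T\<in>cuts (count_list s' r) (map (\<lambda>a. a + (r - 1)) s).
        phi_sur_basis v (m' + m - 1) (substitute r (relabel r m) s' T) w)"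
proof -
  define M where "M = m' + m - 1"
  \<comment> \<open>The test for repetitions and the resulting tensor depend only on the family of
    faces, which is the form that \<open>sum_cuts_compose\<close> handles.\<close>
  define F where "F A = (if \<forall>c\<in>{1..M}. distinct (A c) then ind (map A [1..<Suc M]) w else 0)"
    for A :: "nat \<Rightarrow> nat list"
  define s2 where "s2 = map (\<lambda>a. a + (r - 1)) s"
  have sv: "sorted v" using v by (simp add: strict_sorted_iff)
  have "(if \<forall>c\<in>{1..m'}. distinct (gather c s' P)
      then tens (r - 1) (r - 1) idm (tens 1 m (\<lambda>u. phi_sur_basis (hd u) m s) idm)
        (map (\<lambda>c. gather c s' P) [1..<Suc m']) w else 0)
    = (\<Sum>Q\<in>cuts (length s2) (gather r s' P). F (\<lambda>c. if c \<in> {r..<r + m} then gather c s2 Q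
                   else gather c (map (relabel r m) s') P))" (is "?lhs = ?rhs")
    if P: "P \<in> cuts (length s') v" for P
  proof -
    define U where "U = map (\<lambda>c. gather c s' P) [1..<Suc m']"
    let ?okP = "\<forall>c\<in>{1..m'}. distinct (gather c s' P)"
    let ?w = "drop (r - 1) w"
    have ne: "gather r s' P \<noteq> []"
      using P s' r by (intro gather_nonempty) (auto dest: length_cuts cuts_nonempty)
    have hd: "hd (take 1 (drop (r - 1) U)) = gather r s' P" "drop 1 (drop (r - 1) U) = drop r U"
      using r by (auto simp: U_def hd_drop_conv_nth hd_take)
    have "tens (r - 1) (r - 1) idm (tens 1 m (\<lambda>u. phi_sur_basis (hd u) m s) idm) U w
      = ind (take (r - 1) U) (take (r - 1) w)
        * (phi_sur_basis (gather r s' P) m s (take m ?w) * ind (drop r U) (drop m ?w))"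
      unfolding tens_def idm_def hd by (rule refl)
    also have "\<dots> = (\<Sum>Q\<in>cuts (length s) (gather r s' P).
        ind (take (r - 1) U) (take (r - 1) w)
        * ((if \<forall>c\<in>{1..m}. distinct (gather c s Q)
           then ind (map (\<lambda>c. gather c s Q) [1..<Suc m]) (take m ?w) else 0)
        * ind (drop r U) (drop m ?w)))"
      unfolding phi_sur_basis_eq[OF ne] sum_distrib_right sum_distrib_left by (rule refl)
    also have "\<dots> = (\<Sum>Q\<in>cuts (length s) (gather r s' P).
        if \<forall>c\<in>{1..m}. distinct (gather c s Q)
           then ind (take (r - 1) U @ map (\<lambda>c. gather c s Q) [1..<Suc m] @ drop r U) w else 0)"
    proof (intro sum.cong refl)
      fix Q
      have if_times: "p * ((if C then q else 0) * q') = (if C then p * (q * q') else 0)"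
        for p q q' :: bit and C
        by (cases C) (simp_all only: if_True if_False mult_zero_left mult_zero_right)
      have "length (take (r - 1) U) = r - 1" using r by (simp add: U_def)
      note a1 = ind_append[OF this]
      have a2: "ind (map (\<lambda>c. gather c s Q) [1..<Suc m]) (take m ?w) * ind (drop r U) (drop m ?w)
        = ind (map (\<lambda>c. gather c s Q) [1..<Suc m] @ drop r U) ?w"
        by (rule ind_append) simp
      show "ind (take (r - 1) U) (take (r - 1) w)
        * ((if \<forall>c\<in>{1..m}. distinct (gather c s Q)
           then ind (map (\<lambda>c. gather c s Q) [1..<Suc m]) (take m ?w) else 0)
        * ind (drop r U) (drop m ?w))
        = (if \<forall>c\<in>{1..m}. distinct (gather c s Q)
           then ind (take (r - 1) U @ map (\<lambda>c. gather c s Q) [1..<Suc m] @ drop r U) w else 0)"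
        by (simp only: if_times a1 a2)
    qed
    finally have T: "tens (r - 1) (r - 1) idm (tens 1 m (\<lambda>u. phi_sur_basis (hd u) m s) idm) U w = \<dots>" .
    have "?rhs = (\<Sum>Q\<in>cuts (length s) (gather r s' P).
        if ?okP \<and> (\<forall>c\<in>{1..m}. distinct (gather c s Q))
           then ind (take (r - 1) U @ map (\<lambda>c. gather c s Q) [1..<Suc m] @ drop r U) w else 0)"
      unfolding F_def M_def s2_def length_map U_def
      by (intro sum.cong refl) (simp only: compose_faces[OF s' s r sv P])
    also have "\<dots> = ?lhs"
      unfolding U_def[symmetric] T by (rule sum_if_conj)
    finally show ?thesis ..
  qed
  then have "(\<Sum>P\<in>cuts (length s') v. if \<forall>c\<in>{1..m'}. distinct (gather c s' P)
      then tens (r - 1) (r - 1) idm (tens 1 m (\<lambda>u. phi_sur_basis (hd u) m s) idm)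
        (map (\<lambda>c. gather c s' P) [1..<Suc m']) w else 0)
    = (\<Sum>P\<in>cuts (length s') v. \<Sum>Q\<in>cuts (length s2) (gather r s' P).
        F (\<lambda>c. if c \<in> {r..<r + m} then gather c s2 Q else gather c (map (relabel r m) s') P))"
    by (intro sum.cong refl)
  \<comment> \<open>The shifted letters of \<open>s\<close> lie in \<open>{r..<r + m}\<close>, and
    \<open>relabel\<close> keeps all letters of \<open>s'\<close> other than \<open>r\<close> out of
    this block.\<close>
  also have "\<dots> = (\<Sum>T\<in>cuts (count_list s' r) s2. \<Sum>R\<in>cuts (length (substitute r (relabel r m) s' T)) v.
      F (\<lambda>c. gather c (substitute r (relabel r m) s' T) R))"
    by (rule sum_cuts_compose) (use s' s r in \<open>auto simp: s2_def relabel_def\<close>)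
  also have "\<dots> = (\<Sum>T\<in>cuts (count_list s' r) s2. phi_sur_basis v M (substitute r (relabel r m) s' T) w)"
    by (simp only: F_def phi_sur_basis_eq[OF v(1)])
  finally show ?thesis by (simp only: M_def s2_def)
qed

section \<open>Linear combinations and the induction over trees\<close>

lemma lin_eq_sum_supp: "lin f z w = (\<Sum>s\<in>supp z. f s w)" for w
  unfolding lin_def by (intro sum.cong refl) (simp add: supp_def)

lemma sur_comp_eq:
  assumes "\<And>s. s \<in> supp z \<Longrightarrow> s \<noteq> []"
  shows "sur_comp z' r m z w = (\<Sum>s'\<in>supp z'. \<Sum>s\<in>supp z.
    \<Sum>T\<in>cuts (count_list s' r) (map (\<lambda>a. a + (r - 1)) s). ind (substitute r (relabel r m) s' T) w)"
  unfolding sur_comp_def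
proof (intro sum.cong refl)
  fix s' s assume s: "s' \<in> supp z'" "s \<in> supp z"
  then have "z' s' = 1" "z s = 1" by (simp_all add: supp_def)
  then show "z' s' * z s * sur_comp_basis s' r m s w
    = (\<Sum>T\<in>cuts (count_list s' r) (map (\<lambda>a. a + (r - 1)) s). ind (substitute r (relabel r m) s' T) w)"
    by (simp only: mult_1_left sur_comp_basis_eq[OF assms[OF s(2)]])
qed

lemma phi_sur_add:
  assumes "finite (supp z)" "finite (supp z')"
  shows "phi_sur v m (\<lambda>w. z w + z' w) w = phi_sur v m z w + phi_sur v m z' w"
proof -
  have "supp (\<lambda>w. z w + z' w) \<subseteq> supp z \<union> supp z'" by (auto simp: supp_def)
  then show ?thesis
    using assms lin_eq[of "supp z \<union> supp z'" _ "phi_sur_basis v m" w]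
    by (simp only: phi_sur_def finite_Un Un_upper1 Un_upper2 distrib_right sum.distrib)
qed

text \<open>Composition preserves surjectivity by \<open>set_substitute_relabel\<close>, and
  cancellation can only shrink the support.\<close>

lemma Psi_q_surj:
  "wf_tree x \<Longrightarrow> arity x \<ge> 1 \<and> surj_combination (arity x) (Psi_q x)"
proof (induction x)
  case (Gen m s)
  then show ?case by (cases m) (auto simp: surj_combination_def)
next
  case (Comp x r y)
  then have x: "surj_combination (arity x) (Psi_q x)" and y: "surj_combination (arity y) (Psi_q y)" "arity y \<ge> 1"
    and r: "1 \<le> r" "r \<le> arity x" by auto
  let ?c = "sur_comp (Psi_q x) r (arity y) (Psi_q y)"
  let ?I = "\<Union>s'\<in>supp (Psi_q x). \<Union>s\<in>supp (Psi_q y).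
      (\<lambda>T. substitute r (relabel r (arity y)) s' T) ` cuts (count_list s' r) (map (\<lambda>a. a + (r - 1)) s)"
  have eq: "?c = (\<lambda>w. \<Sum>s'\<in>supp (Psi_q x). \<Sum>s\<in>supp (Psi_q y).
    \<Sum>T\<in>cuts (count_list s' r) (map (\<lambda>a. a + (r - 1)) s). ind (substitute r (relabel r (arity y)) s' T) w)"
    using y by (intro ext sur_comp_eq) (auto simp: surj_combination_def)
  have "supp ?c \<subseteq> ?I"
    unfolding eq by (intro order_trans[OF supp_sum] UN_mono order_refl) auto
  moreover have "finite ?I" using x y by (auto simp: surj_combination_def)
  moreover have "set t = {1..arity x + arity y - 1}" if "t \<in> ?I" for t
  proof -
    from that obtain s' s T where "s' \<in> supp (Psi_q x)" "s \<in> supp (Psi_q y)"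
      and T: "T \<in> cuts (count_list s' r) (map (\<lambda>a. a + (r - 1)) s)"
      and t: "t = substitute r (relabel r (arity y)) s' T" by blast
    then have "set s' = {1..arity x}" "set s = {1..arity y}"
      using x y by (auto simp: surj_combination_def)
    then show ?thesis unfolding t by (rule set_substitute_relabel[OF _ _ y(2) r T])
  qed
  moreover have "arity x + arity y - 1 \<ge> 1" using y r by simp
  moreover have "t \<noteq> []" if "set t = {1..k}" "k \<ge> 1" for t and k :: nat
    using that by auto
  ultimately show ?case
    unfolding surj_combination_def Psi_q.simps arity.simps by (meson finite_subset subsetD)
next
  case (Add x y)
  then have x: "arity x \<ge> 1" "surj_combination (arity x) (Psi_q x)" "surj_combination (arity x) (Psi_q y)"
    by auto
  define z where "z = (\<lambda>w. Psi_q x w + Psi_q y w)"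
  have sub: "supp z \<subseteq> supp (Psi_q x) \<union> supp (Psi_q y)" by (auto simp: supp_def z_def)
  have "finite (supp z)"
    by (rule finite_subset[OF sub]) (use x in \<open>simp add: surj_combination_def\<close>)
  moreover have "s \<noteq> [] \<and> set s = {1..arity x}" if "s \<in> supp z" for s
    using x(2,3) subsetD[OF sub that] unfolding surj_combination_def by auto
  ultimately show ?case
    using x(1) unfolding surj_combination_def Psi_q.simps arity.simps z_def[symmetric] by simp
qed

text \<open>Arbitrary increasing lists are allowed because in a composition \<open>y\<close> is
  applied to a face produced by \<open>x\<close>, not to the full simplex.\<close>

lemma evS_eq_phi_sur:
  "wf_tree x \<Longrightarrow> v \<noteq> [] \<Longrightarrow> sorted_wrt (<) v \<Longrightarrow> evS x [v] w = phi_sur v (arity x) (Psi_q x) w"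
proof (induction x arbitrary: v w)
  case (Gen m s)
  then show ?case by (simp add: surjlike_eq phi_sur_def)
next
  case (Add x y)
  then have fin: "finite (supp (Psi_q x))" "finite (supp (Psi_q y))"
    using Psi_q_surj[of x] Psi_q_surj[of y] by (auto simp: surj_combination_def)
  have ev: "evS x [v] w = phi_sur v (arity x) (Psi_q x) w"
    "evS y [v] w = phi_sur v (arity x) (Psi_q y) w"
    using Add by auto
  show ?case by (simp only: evS.simps arity.simps Psi_q.simps phi_sur_add[OF fin] ev)
next
  case (Comp x r y)
  define z' z m' m where "z' = Psi_q x" and "z = Psi_q y" and "m' = arity x" and "m = arity y"
  note defs = z'_def z_def m'_def m_def
  have z': "finite (supp z')" "\<And>s. s \<in> supp z' \<Longrightarrow> set s = {1..m'}"
    using Psi_q_surj[of x] Comp.prems by (auto simp: defs surj_combination_def)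
  have z: "finite (supp z)" "\<And>s. s \<in> supp z \<Longrightarrow> set s = {1..m}" "\<And>s. s \<in> supp z \<Longrightarrow> s \<noteq> []" "m \<ge> 1"
    using Psi_q_surj[of y] Comp.prems by (auto simp: defs surj_combination_def)
  have r: "1 \<le> r" "r \<le> m'" using Comp.prems by (auto simp: defs)
  let ?E = "tens (r - 1) (r - 1) idm (tens 1 m (evS y) idm)"
  let ?B = "\<lambda>s. tens (r - 1) (r - 1) idm (tens 1 m (\<lambda>u. phi_sur_basis (hd u) m s) idm)"
  have x: "evS x [v] = (\<lambda>w. \<Sum>s'\<in>supp z'. \<Sum>P\<in>cuts (length s') v.
      if \<forall>c\<in>{1..m'}. distinct (gather c s' P) then ind (map (\<lambda>c. gather c s' P) [1..<Suc m']) w else 0)"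
  proof
    fix w
    have "evS x [v] w = phi_sur v m' z' w"
      unfolding defs using Comp.prems by (intro Comp.IH(1)) auto
    then show "evS x [v] w = (\<Sum>s'\<in>supp z'. \<Sum>P\<in>cuts (length s') v.
      if \<forall>c\<in>{1..m'}. distinct (gather c s' P) then ind (map (\<lambda>c. gather c s' P) [1..<Suc m']) w else 0)"
      by (simp only: phi_sur_def lin_eq_sum_supp phi_sur_basis_eq[OF Comp.prems(2)])
  qed
  have fin: "finite (supp (\<lambda>w. \<Sum>P\<in>A. if C P then ind (g P) w else 0))"
    if "finite A" for A :: "'b set" and C and g :: "'b \<Rightarrow> nat list list"
    unfolding sum.inter_filter[OF that, symmetric] using that by (intro finite_supp_sum) auto
  have "evS (Comp x r y) [v] w = lin ?E (evS x [v]) w"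
    by (simp only: evS.simps compose_def m_def)
  also have "\<dots> = (\<Sum>s'\<in>supp z'. \<Sum>P\<in>cuts (length s') v.
      if \<forall>c\<in>{1..m'}. distinct (gather c s' P) then ?E (map (\<lambda>c. gather c s' P) [1..<Suc m']) w else 0)"
    unfolding x lin_sum[OF z'(1) fin[OF finite_cuts]] by (simp only: lin_sum_ind_if[OF finite_cuts])
  also have "\<dots> = (\<Sum>s'\<in>supp z'. \<Sum>P\<in>cuts (length s') v. \<Sum>s\<in>supp z.
      if \<forall>c\<in>{1..m'}. distinct (gather c s' P) then ?B s (map (\<lambda>c. gather c s' P) [1..<Suc m']) w else 0)"
  proof (intro sum.cong refl)
    fix s' P assume s': "s' \<in> supp z'" and P: "P \<in> cuts (length s') v"
    define U where "U = map (\<lambda>c. gather c s' P) [1..<Suc m']"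
    \<comment> \<open>Only families of faces without repetitions survive the outer test. Their
      \<open>r\<close>-th member is then strictly increasing, so the induction hypothesis for
      \<open>y\<close> applies to it.\<close>
    have "?E U w = (\<Sum>s\<in>supp z. ?B s U w)" if ok: "\<forall>c\<in>{1..m'}. distinct (gather c s' P)"
    proof -
      have "take 1 (drop (r - 1) U) = [gather r s' P]"
        using r nth_upt[of 1 "r - 1" "Suc m'"] by (simp add: U_def take_Suc hd_drop_conv_nth)
      moreover have "gather r s' P \<noteq> []"
        using P z'(2)[OF s'] r by (intro gather_nonempty) (auto dest: length_cuts cuts_nonempty)
      moreover have "sorted_wrt (<) (gather r s' P)"
        using strict_sorted_gather_cuts[OF P, of r] ok r Comp.prems by (simp add: strict_sorted_iff)
      ultimately have "evS y (take 1 (drop (r - 1) U)) u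
          = (\<Sum>s\<in>supp z. phi_sur_basis (hd (take 1 (drop (r - 1) U))) m s u)" for u
        using Comp.IH(2)[of "gather r s' P" u] Comp.prems
        by (simp add: phi_sur_def lin_eq_sum_supp defs)
      then show ?thesis
        unfolding tens_def by (simp only: sum_distrib_left sum_distrib_right)
    qed
    then show "(if \<forall>c\<in>{1..m'}. distinct (gather c s' P) then ?E (map (\<lambda>c. gather c s' P) [1..<Suc m']) w else 0)
      = (\<Sum>s\<in>supp z. if \<forall>c\<in>{1..m'}. distinct (gather c s' P) then ?B s (map (\<lambda>c. gather c s' P) [1..<Suc m']) w else 0)"
      unfolding U_def[symmetric] sum_if_outer by (rule if_cong[OF refl _ refl])
  qed
  also have "\<dots> = (\<Sum>s'\<in>supp z'. \<Sum>s\<in>supp z. \<Sum>P\<in>cuts (length s') v.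
      if \<forall>c\<in>{1..m'}. distinct (gather c s' P) then ?B s (map (\<lambda>c. gather c s' P) [1..<Suc m']) w else 0)"
    by (intro sum.cong refl sum.swap)
  also have "\<dots> = (\<Sum>s'\<in>supp z'. \<Sum>s\<in>supp z.
      \<Sum>T\<in>cuts (count_list s' r) (map (\<lambda>a. a + (r - 1)) s).
        phi_sur_basis v (m' + m - 1) (substitute r (relabel r m) s' T) w)"
    using z' z r Comp.prems by (intro sum.cong refl phi_sur_basis_compose) auto
  also have "\<dots> = phi_sur v (m' + m - 1) (sur_comp z' r m z) w"
  proof -
    have eq: "sur_comp z' r m z = (\<lambda>w. \<Sum>s'\<in>supp z'. \<Sum>s\<in>supp z.
      \<Sum>T\<in>cuts (count_list s' r) (map (\<lambda>a. a + (r - 1)) s). ind (substitute r (relabel r m) s' T) w)"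
      using z by (intro ext sur_comp_eq) auto
    have fin1: "finite (supp (\<lambda>w. \<Sum>T\<in>cuts k t. ind (h T) w))"
      for k and t :: "nat list" and h :: "nat list list \<Rightarrow> nat list"
      by (intro finite_supp_sum) auto
    show ?thesis
      unfolding phi_sur_def eq lin_sum[OF z'(1) finite_supp_sum[OF z(1) fin1]] lin_sum[OF z(1) fin1]
      by (simp only: lin_sum_ind[OF finite_cuts])
  qed
  finally show ?case by (simp add: defs)
qed

theorem theoremA11:
  fixes X :: "nat \<Rightarrow> 'a set" and act :: "nat \<Rightarrow> nat list \<Rightarrow> 'a \<Rightarrow> 'a"
    and x :: shtree and d :: nat and \<sigma> :: 'a
  assumes "is_sset X act" and "wf_tree x" and "\<sigma> \<in> X d"
  shows "Uphi_X X act x d \<sigma> = phi_X X act (arity x) (Psi_q x) d \<sigma>"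
proof -
  \<comment> \<open>Both families already agree on the top simplex of each standard simplex, so
    their Kan extensions agree.\<close>
  have "evS x [[0..<Suc d]] = phi_sur [0..<Suc d] (arity x) (Psi_q x)"
    using assms(2) by (intro ext evS_eq_phi_sur) simp_all
  then show ?thesis by (simp add: Uphi_X_def phi_X_def)
qed

end
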